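(* The following hold: (i) $2^n\cdot 41$ is an $ndh$-number for every integer $n\ge 0$. (ii) $3^n\cdot 41$ is an $ndh$-number for every integer $n\ge 0$. (iii) If $x$ is an $ndh$-number, then at least one of $2x$ and $3x$ is an $ndh$-number. (iv) Every prime $p$ with $p\equiv 41 \pmod{48}$ is an $ndh$-number.
   Context: A harmonic number is a positive integer of the form $2^a3^b$ with $a,b\ge 0$ integers (so $1$ is harmonic). A positive integer is an $ndh$-number if it cannot be written as a difference $h-k$ of two harmonic numbers $h,k$. *)

theory Defs
  imports "HOL-Number_Theory.Cong" "HOL-Computational_Algebra.Primes"
begin

definition harmonic :: "nat \<Rightarrow> bool" where
  "harmonic h \<longleftrightarrow> (\<exists>a b :: nat. h = 2 ^ a * 3 ^ b)"

text \<open>The difference is taken in the integers, since subtraction on the naturals truncates.\<close>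

definition ndh :: "nat \<Rightarrow> bool" where
  "ndh x \<longleftrightarrow> x > 0 \<and> \<not> (\<exists>h k. harmonic h \<and> harmonic k \<and> int x = int h - int k)"

end

theory Submission
  imports Defs
begin

text \<open>
  Parts (i), (ii) and (iv) are congruence arguments. In (iii), if \<open>x\<close> is an ndh-number and neither
  \<open>2x\<close> nor \<open>3x\<close> is, then cancelling common factors gives \<open>2x = 3^b - 3^d\<close> and \<open>3x = 2^e - 2^f\<close>, so
  \<open>6x\<close> is both a difference of powers of 3 and a difference of powers of 2. This is Pillai's equation
  \<open>3^a - 2^e = 3^c - 2^f\<close>, whose solutions give \<open>6x \<in> {6, 24, 240}\<close>, and 1, 4, 40 are differences of
  harmonic numbers.

  Pillai's equation is solved following an idea of Scott. With \<open>k\<close> the absolute value of the common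
  difference, each solution is an element \<open>A \<surd>D + \<surd>(-k)\<close> (with \<open>D \<in> {1, 2, 3}\<close>, up to a factor 1/2)
  whose norm is a power of a single prime \<open>p \<in> {2, 3}\<close>. All such elements are, up to sign and
  conjugation, odd powers of the one \<open>\<beta> = u \<surd>D + v \<surd>(-k)\<close> of least norm. Comparing coefficients of
  \<open>\<beta>^m\<close> and \<open>\<beta>\<close>: if \<open>p = 3\<close>, the first coefficient of \<open>\<beta>^m\<close> is an odd multiple of \<open>u\<close>, so there is only
  one solution; if \<open>p = 2\<close>, the quotient is prime to 3 unless \<open>3 | m\<close>, so a second solution is the cube of
  another one and can be computed.
\<close>

section \<open>Elements whose norm is a prime power\<close>

text \<open>As \<open>p\<close> does not divide \<open>x + y\<close>, it misses one of the factors,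
  so all of \<open>p ^ r\<close> sits in the other. This decides below between a product with an
  element and one with its conjugate.\<close>

lemma prime_power_split:
  fixes x y p k :: int
  assumes p: "prime p" and xy: "x * y = p ^ r * k" and ndvd: "\<not> p dvd x + y"
  obtains z where "x = p ^ r * z" "z dvd k" | z where "y = p ^ r * z" "z dvd k"
proof -
  have pos: "p \<noteq> 0" using p by auto
  have "\<not> p dvd x \<or> \<not> p dvd y" using ndvd by auto
  then show thesis
  proof
    assume "\<not> p dvd x"
    then have "coprime (p ^ r) x" using p by (simp add: prime_imp_coprime)
    moreover have "p ^ r dvd x * y" using xy by simp
    ultimately have "p ^ r dvd y" by (simp add: coprime_dvd_mult_right_iff)
    then obtain z where z: "y = p ^ r * z" by blast
    then have "p ^ r * (x * z) = p ^ r * k" using xy by (simp add: algebra_simps)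
    then have "x * z = k" using pos by simp
    then show thesis using that(2)[OF z] by auto
  next
    assume "\<not> p dvd y"
    then have "coprime (p ^ r) y" using p by (simp add: prime_imp_coprime)
    moreover have "p ^ r dvd x * y" using xy by simp
    ultimately have "p ^ r dvd x" by (simp add: coprime_dvd_mult_left_iff)
    then obtain z where z: "x = p ^ r * z" by blast
    then have "p ^ r * (z * y) = p ^ r * k" using xy by (simp add: algebra_simps)
    then have "z * y = k" using pos by simp
    then show thesis using that(1)[OF z] by auto
  qed
qed

text \<open>
  A pair \<open>(a, b)\<close> stands for the element \<open>(a \<surd>D\<^sub>1 + b \<surd>(-D\<^sub>2)) / \<mu>\<close>, of norm
  \<open>(D\<^sub>1 a\<^sup>2 + D\<^sub>2 b\<^sup>2) / \<mu>\<^sup>2\<close>. The flag \<open>odd_only\<close> restricts attention to odd exponents \<open>n\<close>; this excludes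
  even powers when \<open>D\<^sub>1 = 1\<close>, where units of this shape exist.
\<close>

locale norm_form =
  fixes D\<^sub>1 D\<^sub>2 \<mu> p :: int and odd_only :: bool
  assumes param: "p = 3 \<and> \<mu> = 1 \<or> p = 2 \<and> \<mu> = 2"
    and D_pos: "D\<^sub>1 > 0" "D\<^sub>2 > 0"
    and p_ndvd_D: "\<not> p dvd D\<^sub>1" "\<not> p dvd D\<^sub>2"
    and D_large: "D\<^sub>1 * D\<^sub>2 > \<mu>\<^sup>2"
    and no_unit: "\<not> odd_only \<Longrightarrow> D\<^sub>1 * a\<^sup>2 + D\<^sub>2 * b\<^sup>2 \<noteq> \<mu>\<^sup>2"
begin

text \<open>Indivisibility by \<open>p\<close> makes the element primitive; for \<open>p = 2\<close>
  both coordinates are odd, so the denominator 2 is really present.\<close>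

definition rep :: "nat \<Rightarrow> int \<Rightarrow> int \<Rightarrow> bool" where
  "rep n a b \<longleftrightarrow> n > 0 \<and> (odd_only \<longrightarrow> odd n) \<and> D\<^sub>1 * a\<^sup>2 + D\<^sub>2 * b\<^sup>2 = \<mu>\<^sup>2 * p ^ n \<and>
     \<not> p dvd a \<and> \<not> p dvd b"

definition min_rep :: "nat \<Rightarrow> int \<Rightarrow> int \<Rightarrow> bool" where
  "min_rep h u v \<longleftrightarrow> rep h u v \<and> (\<forall>m a b. rep m a b \<longrightarrow> h \<le> m)"

lemma repD:
  assumes "rep n a b"
  shows "n > 0" "odd_only \<Longrightarrow> odd n" "D\<^sub>1 * a\<^sup>2 + D\<^sub>2 * b\<^sup>2 = \<mu>\<^sup>2 * p ^ n"
    "\<not> p dvd a" "\<not> p dvd b"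
  using assms unfolding rep_def by blast+

lemma min_repD: "min_rep h u v \<Longrightarrow> rep h u v"
  by (simp add: min_rep_def)

lemma prime_p: "prime p"
  using param by auto

lemma mu_pos: "\<mu> > 0"
  using param by auto

text \<open>For \<open>p = 3\<close> the factor 2 is a unit modulo \<open>p\<close>; for
  \<open>p = 2\<close> it cancels against \<open>\<mu> = 2\<close>.\<close>

lemma ndvd_of_double:
  assumes "\<mu> * x = 2 * y" "\<not> p dvd y"
  shows "\<not> p dvd x"
  using param
proof
  assume "p = 3 \<and> \<mu> = 1"
  then show ?thesis using assms by simp presburger
next
  assume "p = 2 \<and> \<mu> = 2"
  then show ?thesis using assms by simp
qed

lemma coprime_D1: "coprime D\<^sub>1 (\<mu> * p ^ r)"
proof -
  have "coprime D\<^sub>1 p" using p_ndvd_D(1) prime_p prime_imp_coprime coprime_commute by blast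
  then show ?thesis using param by auto
qed

text \<open>
  Here \<open>(s, t)\<close> stands for \<open>(s + t \<surd>(-D\<^sub>1 D\<^sub>2)) / \<mu>\<close>. One of the products of \<open>(a, b)\<close> with this element
  and with its conjugate is divisible by \<open>p ^ min n l\<close>.
\<close>

lemma mult_erep:
  assumes ab: "D\<^sub>1 * a\<^sup>2 + D\<^sub>2 * b\<^sup>2 = \<mu>\<^sup>2 * p ^ n" "\<not> p dvd a" "\<not> p dvd b"
    and st: "s\<^sup>2 + D\<^sub>1 * D\<^sub>2 * t\<^sup>2 = \<mu>\<^sup>2 * p ^ l" "\<not> p dvd s" "\<not> p dvd t"
    and r: "r = min n l"
  obtains \<sigma> a' b' where "\<sigma> = 1 \<or> \<sigma> = -1"
    "s * a + \<sigma> * D\<^sub>2 * t * b = \<mu> * p ^ r * a'" "s * b - \<sigma> * D\<^sub>1 * t * a = \<mu> * p ^ r * b'"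
    "D\<^sub>1 * a'\<^sup>2 + D\<^sub>2 * b'\<^sup>2 = \<mu>\<^sup>2 * p ^ (n + l - 2 * r)"
    "n \<noteq> l \<Longrightarrow> \<not> p dvd a' \<and> \<not> p dvd b'"
proof -
  have pne: "p \<noteq> 0" "\<mu> \<noteq> 0" using param by auto
  have "\<mu> dvd s * b - D\<^sub>1 * t * a" "\<mu> dvd s * b + D\<^sub>1 * t * a"
    using param ab(2,3) st(2,3) p_ndvd_D by auto
  then obtain x y where x: "s * b - D\<^sub>1 * t * a = \<mu> * x" and y: "s * b + D\<^sub>1 * t * a = \<mu> * y"
    by (meson dvdE)
  define k where "k = b\<^sup>2 * p ^ (l - r) - D\<^sub>1 * t\<^sup>2 * p ^ (n - r)"
  have pl: "p ^ l = p ^ r * p ^ (l - r)" and pn: "p ^ n = p ^ r * p ^ (n - r)"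
    using r by (simp_all flip: power_add)
  \<comment> \<open>The difference of squares is a combination of the two norms, which are both
    divisible by \<open>p ^ r\<close>.\<close>
  have "\<mu>\<^sup>2 * (x * y) = (s * b - D\<^sub>1 * t * a) * (s * b + D\<^sub>1 * t * a)"
    unfolding x y by (simp add: power2_eq_square)
  also have "\<dots> = b\<^sup>2 * (s\<^sup>2 + D\<^sub>1 * D\<^sub>2 * t\<^sup>2) - D\<^sub>1 * t\<^sup>2 * (D\<^sub>1 * a\<^sup>2 + D\<^sub>2 * b\<^sup>2)"
    by algebra
  also have "\<dots> = \<mu>\<^sup>2 * (p ^ r * k)"
    unfolding ab(1) st(1) k_def pl pn by algebra
  finally have xy: "x * y = p ^ r * k" using pne by simp
  have "\<mu> * (x + y) = 2 * (s * b)" using x y by algebra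
  moreover have "\<not> p dvd s * b" using st ab prime_p by (simp add: prime_dvd_mult_iff)
  ultimately have ndvd: "\<not> p dvd x + y" by (rule ndvd_of_double)
  \<comment> \<open>If the exponents differ, exactly one of the two terms of \<open>k\<close> keeps
    a factor \<open>p\<close>.\<close>
  have k: "\<not> p dvd k" if "n \<noteq> l"
  proof -
    have nb: "\<not> p dvd b\<^sup>2" "\<not> p dvd D\<^sub>1 * t\<^sup>2"
      using ab(3) st(3) p_ndvd_D prime_p by (auto simp: prime_dvd_mult_iff prime_dvd_power_iff)
    show ?thesis
    proof (cases "n < l")
      case True
      then have "k = b\<^sup>2 * p ^ (l - n) - D\<^sub>1 * t\<^sup>2" "p dvd b\<^sup>2 * p ^ (l - n)"
        using r by (simp_all add: k_def dvd_power)
      then show ?thesis using nb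
        by (metis dvd_diff_right_iff)
    next
      case False
      then have "k = b\<^sup>2 - D\<^sub>1 * t\<^sup>2 * p ^ (n - l)" "p dvd D\<^sub>1 * t\<^sup>2 * p ^ (n - l)"
        using r that by (simp_all add: k_def dvd_power)
      then show ?thesis using nb
        by (metis dvd_diff_left_iff)
    qed
  qed
  obtain \<sigma> z :: int where \<sigma>: "\<sigma> = 1 \<or> \<sigma> = -1" and b': "s * b - \<sigma> * D\<^sub>1 * t * a = \<mu> * p ^ r * z"
    and z: "z dvd k"
  proof (rule prime_power_split[OF prime_p xy ndvd])
    fix z assume "x = p ^ r * z" "z dvd k"
    then show thesis using that[of 1 z] x by simp
  next
    fix z assume "y = p ^ r * z" "z dvd k"
    then show thesis using that[of "-1" z] y by simp
  qed
  have \<sigma>2: "\<sigma>\<^sup>2 = 1" using \<sigma> by auto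
  define A where "A = s * a + \<sigma> * D\<^sub>2 * t * b"
  define e where "e = n + l - 2 * r"
  have e: "p ^ (n + l) = (p ^ r)\<^sup>2 * p ^ e"
    unfolding e_def using r by (simp add: power_even_eq flip: power_mult power_add)
  \<comment> \<open>Multiplicativity of the norm: one coordinate of the product is already divisible
    by \<open>\<mu> * p ^ r\<close>, and \<open>D\<^sub>1\<close> is prime to this number, so the
    other coordinate \<open>A\<close> is divisible as well.\<close>
  have "D\<^sub>1 * A\<^sup>2 + D\<^sub>2 * (s * b - \<sigma> * D\<^sub>1 * t * a)\<^sup>2
      = D\<^sub>1 * (s\<^sup>2 * a\<^sup>2 + \<sigma>\<^sup>2 * D\<^sub>2\<^sup>2 * t\<^sup>2 * b\<^sup>2) + D\<^sub>2 * (s\<^sup>2 * b\<^sup>2 + \<sigma>\<^sup>2 * D\<^sub>1\<^sup>2 * t\<^sup>2 * a\<^sup>2)"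
    unfolding A_def by algebra
  also have "\<dots> = (D\<^sub>1 * a\<^sup>2 + D\<^sub>2 * b\<^sup>2) * (s\<^sup>2 + D\<^sub>1 * D\<^sub>2 * t\<^sup>2)"
    unfolding \<sigma>2 by algebra
  also have "\<dots> = (\<mu> * p ^ r)\<^sup>2 * (\<mu>\<^sup>2 * p ^ e)"
    unfolding ab(1) st(1) using e by (simp add: power_add algebra_simps)
  finally have N: "D\<^sub>1 * A\<^sup>2 + D\<^sub>2 * (\<mu> * p ^ r * z)\<^sup>2 = (\<mu> * p ^ r)\<^sup>2 * (\<mu>\<^sup>2 * p ^ e)"
    unfolding b' .
  then have "D\<^sub>1 * A\<^sup>2 = (\<mu> * p ^ r)\<^sup>2 * (\<mu>\<^sup>2 * p ^ e - D\<^sub>2 * z\<^sup>2)"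
    by (simp add: algebra_simps power_mult_distrib)
  then have "(\<mu> * p ^ r)\<^sup>2 dvd D\<^sub>1 * A\<^sup>2" by simp
  moreover have "coprime D\<^sub>1 ((\<mu> * p ^ r)\<^sup>2)" using coprime_D1 by simp
  ultimately have "(\<mu> * p ^ r)\<^sup>2 dvd A\<^sup>2"
    by (metis coprime_commute coprime_dvd_mult_right_iff)
  then have "\<mu> * p ^ r dvd A" by simp
  then obtain a' where a': "A = \<mu> * p ^ r * a'" by blast
  have "(\<mu> * p ^ r)\<^sup>2 * (D\<^sub>1 * a'\<^sup>2 + D\<^sub>2 * z\<^sup>2) = (\<mu> * p ^ r)\<^sup>2 * (\<mu>\<^sup>2 * p ^ e)"
    using N unfolding a' by (simp add: algebra_simps power_mult_distrib)
  then have N': "D\<^sub>1 * a'\<^sup>2 + D\<^sub>2 * z\<^sup>2 = \<mu>\<^sup>2 * p ^ e" using pne by simp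
  have prim: "\<not> p dvd a' \<and> \<not> p dvd z" if "n \<noteq> l"
  proof -
    have nz: "\<not> p dvd z" using k[OF that] z dvd_trans by blast
    have "e > 0" using that r by (auto simp: e_def min_def)
    then have "p dvd \<mu>\<^sup>2 * p ^ e" by (simp add: dvd_power)
    moreover have "\<not> p dvd D\<^sub>2 * z\<^sup>2"
      using nz p_ndvd_D prime_p by (auto simp: prime_dvd_mult_iff prime_dvd_power_iff)
    ultimately have "\<not> p dvd D\<^sub>1 * a'\<^sup>2" using N' by (metis dvd_add_right_iff)
    then show ?thesis using nz by (auto simp: power2_eq_square)
  qed
  show thesis
    using that[of \<sigma> a' z] \<sigma> a' b' N' prim by (simp add: A_def e_def)
qed

text \<open>\<open>(s, t)\<close> are the coordinates of the square of \<open>(u, v)\<close>, in the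
  shape that \<open>mult_erep\<close> multiplies by.\<close>

lemma rep_square:
  assumes "rep h u v"
  obtains s t where "\<mu> * s = D\<^sub>1 * u\<^sup>2 - D\<^sub>2 * v\<^sup>2" "\<mu> * t = 2 * u * v"
    "s\<^sup>2 + D\<^sub>1 * D\<^sub>2 * t\<^sup>2 = \<mu>\<^sup>2 * p ^ (2 * h)" "\<not> p dvd s" "\<not> p dvd t"
proof -
  have h: "h > 0" and N: "D\<^sub>1 * u\<^sup>2 + D\<^sub>2 * v\<^sup>2 = \<mu>\<^sup>2 * p ^ h" and nd: "\<not> p dvd u" "\<not> p dvd v"
    using assms by (auto simp: rep_def)
  have ph: "p dvd p ^ h" using h by (simp add: dvd_power)
  have nd': "\<not> p dvd D\<^sub>1 * u\<^sup>2" "\<not> p dvd u * v"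
    using nd p_ndvd_D prime_p by (auto simp: prime_dvd_mult_iff prime_dvd_power_iff)
  obtain s t where s: "\<mu> * s = D\<^sub>1 * u\<^sup>2 - D\<^sub>2 * v\<^sup>2" and t: "\<mu> * t = 2 * u * v"
    and ns: "\<not> p dvd s" and nt: "\<not> p dvd t"
    using param
  proof
    assume pm: "p = 3 \<and> \<mu> = 1"
    have "\<not> 3 dvd 2 * (D\<^sub>1 * u\<^sup>2)" "\<not> 3 dvd 2 * (u * v)"
      using nd' ndvd_of_double pm by auto
    moreover have "D\<^sub>1 * u\<^sup>2 - D\<^sub>2 * v\<^sup>2 = 2 * (D\<^sub>1 * u\<^sup>2) - 3 ^ h" using N pm by simp
    ultimately show thesis
      using that[of "D\<^sub>1 * u\<^sup>2 - D\<^sub>2 * v\<^sup>2" "2 * u * v"] pm ph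
      by (metis dvd_diff_left_iff mult.assoc mult_1)
  next
    assume pm: "p = 2 \<and> \<mu> = 2"
    have "D\<^sub>1 * u\<^sup>2 - D\<^sub>2 * v\<^sup>2 = 2 * (D\<^sub>1 * u\<^sup>2 - 2 * 2 ^ h)" using N pm by simp
    then show thesis
      using that[of "D\<^sub>1 * u\<^sup>2 - 2 * 2 ^ h" "u * v"] pm nd' by simp
  qed
  have "\<mu>\<^sup>2 * (s\<^sup>2 + D\<^sub>1 * D\<^sub>2 * t\<^sup>2) = (\<mu> * s)\<^sup>2 + D\<^sub>1 * D\<^sub>2 * (\<mu> * t)\<^sup>2" by algebra
  also have "\<dots> = (D\<^sub>1 * u\<^sup>2 + D\<^sub>2 * v\<^sup>2)\<^sup>2" unfolding s t by algebra
  also have "\<dots> = \<mu>\<^sup>2 * (\<mu>\<^sup>2 * p ^ (2 * h))"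
    unfolding N by (simp only: power_even_eq power_mult_distrib) (simp add: power2_eq_square)
  finally have "s\<^sup>2 + D\<^sub>1 * D\<^sub>2 * t\<^sup>2 = \<mu>\<^sup>2 * p ^ (2 * h)" using mu_pos
    by (metis mult_cancel_left less_irrefl zero_eq_power2)
  with s t ns nt show thesis using that by blast
qed

text \<open>After conjugating one element if necessary, their quotient has norm 1 and an imaginary
  coordinate \<open>z\<close> that is an integer. \<open>D_large\<close> leaves only
  \<open>z = 0\<close>.\<close>

lemma rep_unique:
  assumes "rep h u v" "rep h a b"
  shows "a\<^sup>2 = u\<^sup>2" "b\<^sup>2 = v\<^sup>2"
proof -
  have N: "D\<^sub>1 * u\<^sup>2 + D\<^sub>2 * v\<^sup>2 = \<mu>\<^sup>2 * p ^ h" "D\<^sub>1 * a\<^sup>2 + D\<^sub>2 * b\<^sup>2 = \<mu>\<^sup>2 * p ^ h"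
    and nd: "\<not> p dvd u" "\<not> p dvd v" "\<not> p dvd a" "\<not> p dvd b"
    using assms by (auto simp: rep_def)
  have pne: "p \<noteq> 0" "\<mu> \<noteq> 0" using param by auto
  have "\<mu> dvd b * u - a * v" "\<mu> dvd b * u + a * v"
    using param nd by auto
  then obtain x y where x: "b * u - a * v = \<mu> * x" and y: "b * u + a * v = \<mu> * y"
    by (meson dvdE)
  have "\<mu>\<^sup>2 * (D\<^sub>2 * (x * y)) = D\<^sub>2 * ((b * u - a * v) * (b * u + a * v))"
    unfolding x y by (simp add: power2_eq_square)
  also have "\<dots> = u\<^sup>2 * (D\<^sub>1 * a\<^sup>2 + D\<^sub>2 * b\<^sup>2) - a\<^sup>2 * (D\<^sub>1 * u\<^sup>2 + D\<^sub>2 * v\<^sup>2)" by algebra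
  also have "\<dots> = \<mu>\<^sup>2 * (p ^ h * (u\<^sup>2 - a\<^sup>2))" unfolding N by algebra
  finally have "D\<^sub>2 * (x * y) = p ^ h * (u\<^sup>2 - a\<^sup>2)" using pne by simp
  moreover have "coprime (p ^ h) D\<^sub>2" using p_ndvd_D prime_p by (simp add: prime_imp_coprime)
  ultimately have "p ^ h dvd x * y"
    by (metis coprime_dvd_mult_right_iff dvd_triv_left)
  then obtain k where xy: "x * y = p ^ h * k" by blast
  have eq: "\<mu> * (x + y) = 2 * (b * u)" using x y by algebra
  have "\<not> p dvd b * u" using nd prime_p by (simp add: prime_dvd_mult_iff)
  with eq have ndvd: "\<not> p dvd x + y" by (rule ndvd_of_double)
  obtain \<sigma> z :: int where \<sigma>: "\<sigma> = 1 \<or> \<sigma> = -1" and z: "b * u - \<sigma> * a * v = \<mu> * p ^ h * z"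
  proof (rule prime_power_split[OF prime_p xy ndvd])
    fix z assume "x = p ^ h * z"
    then show thesis using that[of 1 z] x by simp
  next
    fix z assume "y = p ^ h * z"
    then show thesis using that[of "-1" z] y by simp
  qed
  have \<sigma>2: "\<sigma>\<^sup>2 = 1" using \<sigma> by auto
  have "(D\<^sub>1 * a * u + \<sigma> * D\<^sub>2 * b * v)\<^sup>2 + D\<^sub>1 * D\<^sub>2 * (b * u - \<sigma> * a * v)\<^sup>2
      = (D\<^sub>1 * u\<^sup>2 + \<sigma>\<^sup>2 * D\<^sub>2 * v\<^sup>2) * (D\<^sub>1 * a\<^sup>2 + D\<^sub>2 * b\<^sup>2)"
    by algebra
  also have "\<dots> = (\<mu> * p ^ h)\<^sup>2 * \<mu>\<^sup>2" unfolding \<sigma>2 using N by (simp add: algebra_simps power2_eq_square)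
  finally have "D\<^sub>1 * D\<^sub>2 * (\<mu> * p ^ h * z)\<^sup>2 \<le> (\<mu> * p ^ h)\<^sup>2 * \<mu>\<^sup>2"
    unfolding z by (smt (verit) zero_le_power2)
  then have "(\<mu> * p ^ h)\<^sup>2 * (D\<^sub>1 * D\<^sub>2 * z\<^sup>2) \<le> (\<mu> * p ^ h)\<^sup>2 * \<mu>\<^sup>2"
    by (simp add: power_mult_distrib algebra_simps)
  then have le: "D\<^sub>1 * D\<^sub>2 * z\<^sup>2 \<le> \<mu>\<^sup>2" using pne by (simp add: mult_le_cancel_left)
  have "z = 0"
  proof (rule ccontr)
    assume "z \<noteq> 0"
    then have "z\<^sup>2 \<ge> 1" by (smt (verit) zero_less_power2)
    then have "D\<^sub>1 * D\<^sub>2 * 1 \<le> D\<^sub>1 * D\<^sub>2 * z\<^sup>2" using D_pos by (intro mult_left_mono) auto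
    then show False using le D_large by simp
  qed
  then have "b * u = \<sigma> * a * v" using z by simp
  then have "b\<^sup>2 * u\<^sup>2 = a\<^sup>2 * v\<^sup>2" using \<sigma>2 by algebra
  then have "u\<^sup>2 * (D\<^sub>1 * a\<^sup>2 + D\<^sub>2 * b\<^sup>2) = a\<^sup>2 * (D\<^sub>1 * u\<^sup>2 + D\<^sub>2 * v\<^sup>2)" by algebra
  then have "\<mu>\<^sup>2 * p ^ h * (u\<^sup>2 - a\<^sup>2) = 0" unfolding N by (simp add: algebra_simps)
  then show eq: "a\<^sup>2 = u\<^sup>2" using pne by simp
  have "D\<^sub>2 * b\<^sup>2 = D\<^sub>2 * v\<^sup>2" using N unfolding eq by linarith
  then show "b\<^sup>2 = v\<^sup>2" using D_pos by simp
qed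

text \<open>Division by the square of the minimal element stays within elements of the same shape.\<close>

lemma descent:
  assumes "min_rep h u v" and ab: "rep n a b"
  obtains "n = h" "a\<^sup>2 = u\<^sup>2" "b\<^sup>2 = v\<^sup>2"
  | \<sigma> a' b' where "2 * h < n" "rep (n - 2 * h) a' b'" "\<sigma> = 1 \<or> \<sigma> = -1"
      "\<mu>\<^sup>2 * a = (D\<^sub>1 * u\<^sup>2 - D\<^sub>2 * v\<^sup>2) * a' - \<sigma> * D\<^sub>2 * (2 * u * v) * b'"
      "\<mu>\<^sup>2 * b = (D\<^sub>1 * u\<^sup>2 - D\<^sub>2 * v\<^sup>2) * b' + \<sigma> * D\<^sub>1 * (2 * u * v) * a'"
proof -
  have uv: "rep h u v" and min: "\<And>m a b. rep m a b \<Longrightarrow> h \<le> m"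
    using assms(1) by (auto simp: min_rep_def)
  show thesis
  proof (cases "n = h")
    case True
    then show thesis using rep_unique[OF uv] ab that(1) by blast
  next
    case False
    then have hn: "h < n" using min[OF ab] by simp
    have pne: "p \<noteq> 0" "\<mu> \<noteq> 0" using param by auto
    obtain s t where s: "\<mu> * s = D\<^sub>1 * u\<^sup>2 - D\<^sub>2 * v\<^sup>2" and t: "\<mu> * t = 2 * u * v"
      and N: "s\<^sup>2 + D\<^sub>1 * D\<^sub>2 * t\<^sup>2 = \<mu>\<^sup>2 * p ^ (2 * h)" and nd: "\<not> p dvd s" "\<not> p dvd t"
      by (rule rep_square[OF uv])
    have ab': "D\<^sub>1 * a\<^sup>2 + D\<^sub>2 * b\<^sup>2 = \<mu>\<^sup>2 * p ^ n" "\<not> p dvd a" "\<not> p dvd b"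
      and odd: "odd_only \<Longrightarrow> odd n"
      using ab unfolding rep_def by blast+
    obtain \<sigma> a' b' where \<sigma>: "\<sigma> = 1 \<or> \<sigma> = -1"
      and a': "s * a + \<sigma> * D\<^sub>2 * t * b = \<mu> * p ^ (min n (2 * h)) * a'"
      and b': "s * b - \<sigma> * D\<^sub>1 * t * a = \<mu> * p ^ (min n (2 * h)) * b'"
      and N': "D\<^sub>1 * a'\<^sup>2 + D\<^sub>2 * b'\<^sup>2 = \<mu>\<^sup>2 * p ^ (n + 2 * h - 2 * min n (2 * h))"
      and nd': "n \<noteq> 2 * h \<Longrightarrow> \<not> p dvd a' \<and> \<not> p dvd b'"
      by (rule mult_erep[OF ab' N nd refl]) blast
    consider "n < 2 * h" | "n = 2 * h" | "n > 2 * h" by linarith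
    then show thesis
    proof cases
      \<comment> \<open>The quotient would have exponent \<open>2 * h - n < h\<close>, against
        minimality.\<close>
      case 1
      then have "rep (2 * h - n) a' b'"
        using N' nd' odd by (auto simp: rep_def)
      then show thesis using min hn 1 by fastforce
    next
      \<comment> \<open>The quotient would have norm 1. Oddness of \<open>n\<close> excludes this
        under \<open>odd_only\<close>, and \<open>no_unit\<close> excludes it otherwise.\<close>
      case 2
      then show thesis using N' odd no_unit[of a' b'] by auto
    next
      case 3
      then have r: "min n (2 * h) = 2 * h" by simp
      have rep': "rep (n - 2 * h) a' b'"
        using N' nd' odd 3 r by (auto simp: rep_def)
      have \<sigma>2: "\<sigma>\<^sup>2 = 1" using \<sigma> by auto
      \<comment> \<open>Multiplying the quotient back by \<open>(s, t)\<close> recovers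
        \<open>(a, b)\<close>.\<close>
      have "s * (\<mu> * p ^ (2 * h) * a') - \<sigma> * D\<^sub>2 * t * (\<mu> * p ^ (2 * h) * b')
          = (s\<^sup>2 + \<sigma>\<^sup>2 * D\<^sub>1 * D\<^sub>2 * t\<^sup>2) * a"
        unfolding a'[unfolded r, symmetric] b'[unfolded r, symmetric] by algebra
      then have "\<mu> * p ^ (2 * h) * (s * a' - \<sigma> * D\<^sub>2 * t * b') = (s\<^sup>2 + \<sigma>\<^sup>2 * D\<^sub>1 * D\<^sub>2 * t\<^sup>2) * a"
        by (simp add: algebra_simps)
      also have "\<dots> = \<mu> * p ^ (2 * h) * (\<mu> * a)" unfolding \<sigma>2 using N by (simp add: power2_eq_square)
      finally have "\<mu> * a = s * a' - \<sigma> * D\<^sub>2 * t * b'" using pne by simp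
      then have A: "\<mu>\<^sup>2 * a = (\<mu> * s) * a' - \<sigma> * D\<^sub>2 * (\<mu> * t) * b'" by algebra
      have "s * (\<mu> * p ^ (2 * h) * b') + \<sigma> * D\<^sub>1 * t * (\<mu> * p ^ (2 * h) * a')
          = (s\<^sup>2 + \<sigma>\<^sup>2 * D\<^sub>1 * D\<^sub>2 * t\<^sup>2) * b"
        unfolding a'[unfolded r, symmetric] b'[unfolded r, symmetric] by algebra
      then have "\<mu> * p ^ (2 * h) * (s * b' + \<sigma> * D\<^sub>1 * t * a') = (s\<^sup>2 + \<sigma>\<^sup>2 * D\<^sub>1 * D\<^sub>2 * t\<^sup>2) * b"
        by (simp add: algebra_simps)
      then have "\<mu> * p ^ (2 * h) * (s * b' + \<sigma> * D\<^sub>1 * t * a') = \<mu> * p ^ (2 * h) * (\<mu> * b)"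
        unfolding \<sigma>2 using N by (simp add: power2_eq_square)
      then have "\<mu> * b = s * b' + \<sigma> * D\<^sub>1 * t * a'" using pne by simp
      then have B: "\<mu>\<^sup>2 * b = (\<mu> * s) * b' + \<sigma> * D\<^sub>1 * (\<mu> * t) * a'" by algebra
      show thesis using that(2)[OF 3 rep' \<sigma> A[unfolded s t] B[unfolded s t]] .
    qed
  qed
qed

lemma minimal_rep:
  assumes "rep n a b"
  obtains h u v where "min_rep h u v"
proof -
  have "\<exists>a b. rep (LEAST m. \<exists>a b. rep m a b) a b"
    by (rule LeastI_ex) (use assms in blast)
  moreover have "(LEAST m. \<exists>a b. rep m a b) \<le> m" if "rep m a b" for m a b
    by (rule Least_le) (use that in blast)
  ultimately show thesis using that unfolding min_rep_def by blast
qed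

end

section \<open>Coefficients of powers\<close>

text \<open>
  For \<open>\<beta>\<close> of norm \<open>q\<close> with \<open>w = 4 (Im \<beta>)\<^sup>2\<close>, the ratios of the real and imaginary parts of
  \<open>\<beta>^(2j+1)\<close> to those of \<open>\<beta>\<close>.
\<close>

fun lucas_re :: "int \<Rightarrow> int \<Rightarrow> nat \<Rightarrow> int" where
  "lucas_re q w 0 = 1"
| "lucas_re q w (Suc 0) = q - w"
| "lucas_re q w (Suc (Suc j)) = (2 * q - w) * lucas_re q w (Suc j) - q\<^sup>2 * lucas_re q w j"

fun lucas_im :: "int \<Rightarrow> int \<Rightarrow> nat \<Rightarrow> int" where
  "lucas_im q w 0 = 1"
| "lucas_im q w (Suc 0) = 3 * q - w"
| "lucas_im q w (Suc (Suc j)) = (2 * q - w) * lucas_im q w (Suc j) - q\<^sup>2 * lucas_im q w j"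

text \<open>Multiplication by \<open>\<beta>\<^sup>2\<close>, whose trace is
  \<open>2 * q - w\<close> and whose norm is \<open>q\<^sup>2\<close>.\<close>

lemma lucas_step:
  "2 * lucas_re q w (Suc j) = (2 * q - w) * lucas_re q w j - w * lucas_im q w j"
  "2 * lucas_im q w (Suc j) = (2 * q - w) * lucas_im q w j + (4 * q - w) * lucas_re q w j"
proof (induction j)
  case 0
  { case 1 show ?case by simp }
  { case 2 show ?case by simp }
next
  case (Suc j)
  note IH = Suc.IH
  { case 1
    have "4 * lucas_re q w (Suc (Suc j)) = 2 * ((2 * q - w) * lucas_re q w (Suc j) - w * lucas_im q w (Suc j))"
      using IH unfolding lucas_re.simps by algebra
    then show ?case by simp }
  { case 2
    have "4 * lucas_im q w (Suc (Suc j)) = 2 * ((2 * q - w) * lucas_im q w (Suc j) + (4 * q - w) * lucas_re q w (Suc j))"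
      using IH unfolding lucas_im.simps by algebra
    then show ?case by simp }
qed

text \<open>The norm of \<open>\<beta>^(2j+1)\<close> is \<open>q^(2j+1)\<close>; here
  \<open>4 * q - w\<close> is \<open>4 (Re \<beta>)\<^sup>2\<close>.\<close>

lemma lucas_norm:
  "(4 * q - w) * (lucas_re q w j)\<^sup>2 + w * (lucas_im q w j)\<^sup>2 = 4 * q ^ (2 * j + 1)"
proof (induction j)
  case (Suc j)
  have "4 * ((4 * q - w) * (lucas_re q w (Suc j))\<^sup>2 + w * (lucas_im q w (Suc j))\<^sup>2)
      = (4 * q - w) * (2 * lucas_re q w (Suc j))\<^sup>2 + w * (2 * lucas_im q w (Suc j))\<^sup>2"
    by algebra
  also have "\<dots> = 4 * q\<^sup>2 * ((4 * q - w) * (lucas_re q w j)\<^sup>2 + w * (lucas_im q w j)\<^sup>2)"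
    unfolding lucas_step by algebra
  also have "\<dots> = 4 * (4 * q ^ (2 * Suc j + 1))"
    unfolding Suc.IH by (simp add: power2_eq_square)
  finally show ?case by simp
qed simp

text \<open>The cube of \<open>\<beta>^(2j+1)\<close> is \<open>\<beta>^(2(3j+1)+1)\<close>.\<close>

lemma lucas_triple:
  "lucas_re q w (3 * j + 1) = lucas_re q w j * (q ^ (2 * j + 1) - w * (lucas_im q w j)\<^sup>2)"
  "lucas_im q w (3 * j + 1) = lucas_im q w j * (3 * q ^ (2 * j + 1) - w * (lucas_im q w j)\<^sup>2)"
proof (induction j)
  case 0
  { case 1 show ?case by simp }
  { case 2 show ?case by simp }
next
  case (Suc j)
  define R I where "R = lucas_re q w j" and "I = lucas_im q w j"
  define R' I' where "R' = lucas_re q w (Suc j)" and "I' = lucas_im q w (Suc j)"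
  define r i where "r k = lucas_re q w (3 * j + 1 + k)" and "i k = lucas_im q w (3 * j + 1 + k)" for k
  define Q where "Q = q ^ (2 * j + 1)"
  have Q': "q ^ (2 * Suc j + 1) = q\<^sup>2 * Q" by (simp add: Q_def power2_eq_square)
  have N: "(4 * q - w) * R\<^sup>2 + w * I\<^sup>2 = 4 * Q" unfolding R_def I_def Q_def by (rule lucas_norm)
  have s: "2 * R' = (2 * q - w) * R - w * I" "2 * I' = (2 * q - w) * I + (4 * q - w) * R"
    unfolding R_def I_def R'_def I'_def by (rule lucas_step)+
  have S: "2 * r (Suc k) = (2 * q - w) * r k - w * i k" "2 * i (Suc k) = (2 * q - w) * i k + (4 * q - w) * r k" for k
    unfolding r_def i_def add_Suc_right by (rule lucas_step)+
  \<comment> \<open>Three steps at once, that is, multiplication by \<open>\<beta>^6\<close>: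
    raising \<open>j\<close> by one raises \<open>3 * j + 1\<close> by three.\<close>
  have S3: "8 * r (Suc (Suc (Suc 0))) = (2 * q - w) * ((2 * q - w)\<^sup>2 - 3 * w * (4 * q - w)) * r 0
        - w * (3 * (2 * q - w)\<^sup>2 - w * (4 * q - w)) * i 0"
      "8 * i (Suc (Suc (Suc 0))) = (2 * q - w) * ((2 * q - w)\<^sup>2 - 3 * w * (4 * q - w)) * i 0
        + (4 * q - w) * (3 * (2 * q - w)\<^sup>2 - w * (4 * q - w)) * r 0"
    using S[of 0] S[of "Suc 0"] S[of "Suc (Suc 0)"] by algebra+
  have IH: "r 0 = R * (Q - w * I\<^sup>2)" "i 0 = I * (3 * Q - w * I\<^sup>2)"
    using Suc.IH by (simp_all add: r_def i_def R_def I_def Q_def)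
  have e: "3 * Suc j + 1 = 3 * j + 1 + Suc (Suc (Suc 0))" by simp
  { case 1
    have "32 * r (Suc (Suc (Suc 0))) = 4 * ((2 * R') * (4 * q\<^sup>2 * Q - w * (2 * I')\<^sup>2))"
      using S3(1) unfolding IH s using N by algebra
    then have "r (Suc (Suc (Suc 0))) = R' * (q\<^sup>2 * Q - w * I'\<^sup>2)" by (simp add: algebra_simps power_mult_distrib)
    then show ?case unfolding e Q' r_def R'_def I'_def by simp }
  { case 2
    have "32 * i (Suc (Suc (Suc 0))) = 4 * ((2 * I') * (3 * (4 * q\<^sup>2 * Q) - w * (2 * I')\<^sup>2))"
      using S3(2) unfolding IH s using N by algebra
    then have "i (Suc (Suc (Suc 0))) = I' * (3 * (q\<^sup>2 * Q) - w * I'\<^sup>2)" by (simp add: algebra_simps power_mult_distrib)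
    then show ?case unfolding e Q' i_def I'_def by simp }
qed

text \<open>Modulo 3 the coefficient \<open>2 * q - w\<close> equals \<open>q\<close>. The sequence
  starts \<open>1, 0, -q\<^sup>2\<close>, and three steps multiply it by the unit
  \<open>-q^3\<close>, so its zeros recur with period 3.\<close>

lemma lucas_re_mod_3:
  assumes "3 dvd 4 * q - w" "\<not> 3 dvd q"
  shows "3 dvd lucas_re q w j \<longleftrightarrow> j mod 3 = 1"
proof (induction j rule: less_induct)
  case (less j)
  have q2: "3 dvd q\<^sup>2 - 1"
  proof -
    have "q mod 3 = 1 \<or> q mod 3 = 2" using assms(2) by presburger
    then have "q\<^sup>2 mod 3 = 1" by (auto simp: power2_eq_square mod_mult_eq[of q 3 q, symmetric])
    then show ?thesis by presburger
  qed
  consider "j = 0" | "j = 1" | "j = 2" | i where "j = Suc (Suc (Suc i))"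
    by (metis One_nat_def Suc_1 not0_implies_Suc)
  then show ?case
  proof cases
    case 2 then show ?thesis using assms by simp presburger
  next
    case 3
    have "lucas_re q w j = (2 * q - w) * (q - w) - q\<^sup>2" using 3 by (simp add: numeral_2_eq_2)
    moreover have "3 dvd (2 * q - w) * (q - w)"
      using assms(1) by (intro dvd_mult) presburger
    moreover have "\<not> 3 dvd q\<^sup>2" using q2 by presburger
    ultimately have "\<not> 3 dvd lucas_re q w j" by (simp add: dvd_diff_right_iff)
    then show ?thesis using 3 by simp
  next
    case (4 i)
    define R S where "R = lucas_re q w i" and "S = lucas_re q w (Suc i)"
    have "lucas_re q w j = ((4 * q - w) * (- w) + 3 * q\<^sup>2) * S - (2 * q - w) * q\<^sup>2 * R"
      unfolding 4 R_def S_def lucas_re.simps by algebra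
    moreover have "3 dvd ((4 * q - w) * (- w) + 3 * q\<^sup>2) * S"
      using assms(1) by (intro dvd_mult2 dvd_add) auto
    ultimately have "3 dvd lucas_re q w j \<longleftrightarrow> 3 dvd (2 * q - w) * q\<^sup>2 * R"
      by (simp add: dvd_diff_right_iff)
    also have "\<dots> \<longleftrightarrow> 3 dvd R"
    proof -
      have "prime (3::int)" by simp
      moreover have "\<not> 3 dvd 2 * q - w" "\<not> 3 dvd q\<^sup>2" using assms q2 by presburger+
      ultimately show ?thesis by (simp add: prime_dvd_mult_iff)
    qed
    also have "\<dots> \<longleftrightarrow> i mod 3 = 1" unfolding R_def using less.IH[of i] 4 by simp
    also have "\<dots> \<longleftrightarrow> j mod 3 = 1" unfolding 4 by presburger
    finally show ?thesis .
  qed simp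
qed

lemma dvd_power_3_cases:
  fixes z :: int
  assumes "z dvd 3 ^ i"
  obtains e where "\<bar>z\<bar> = 3 ^ e"
proof -
  have "nat \<bar>z\<bar> dvd 3 ^ i" using assms by (simp add: nat_dvd_iff)
  moreover have "prime (3::nat)" by simp
  ultimately obtain e where "nat \<bar>z\<bar> = 3 ^ e" by (metis divides_primepow_nat)
  then have "\<bar>z\<bar> = 3 ^ e" by (metis abs_ge_zero nat_eq_iff of_nat_numeral of_nat_power)
  then show thesis using that by blast
qed

section \<open>Elements with a coordinate that is a power of 2 or of 3\<close>

context norm_form
begin

text \<open>\<open>D\<^sub>1 * u\<^sup>2 - D\<^sub>2 * v\<^sup>2\<close> is odd because the norm is
  a power of 3, and the cross term carries a factor 2; so each descent step preserves the parity of
  the first quotient.\<close>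

lemma odd_quotient:
  assumes p: "p = 3" and min: "min_rep h u v" and "rep n a b"
  shows "\<exists>x y. a = u * x \<and> b = v * y \<and> odd x"
  using assms(3)
proof (induction n arbitrary: a b rule: less_induct)
  case (less n)
  have \<mu>: "\<mu> = 1" using p param by auto
  have uv: "rep h u v" using min by (rule min_repD)
  have "D\<^sub>1 * u\<^sup>2 + D\<^sub>2 * v\<^sup>2 = 3 ^ h" using repD(3)[OF uv] p \<mu> by simp
  then have "odd (D\<^sub>1 * u\<^sup>2 + D\<^sub>2 * v\<^sup>2)" by simp
  then have s: "odd (D\<^sub>1 * u\<^sup>2 - D\<^sub>2 * v\<^sup>2)" by simp
  show ?case
  proof (rule descent[OF min less.prems])
    assume "a\<^sup>2 = u\<^sup>2" "b\<^sup>2 = v\<^sup>2"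
    then have "a = u * 1 \<or> a = u * (-1)" "b = v * 1 \<or> b = v * (-1)"
      by (auto simp: power2_eq_iff)
    then show ?thesis by (metis odd_one dvd_minus_iff)
  next
    fix \<sigma> a' b'
    assume h: "2 * h < n" "rep (n - 2 * h) a' b'" "\<sigma> = 1 \<or> \<sigma> = -1"
      and a: "\<mu>\<^sup>2 * a = (D\<^sub>1 * u\<^sup>2 - D\<^sub>2 * v\<^sup>2) * a' - \<sigma> * D\<^sub>2 * (2 * u * v) * b'"
      and b: "\<mu>\<^sup>2 * b = (D\<^sub>1 * u\<^sup>2 - D\<^sub>2 * v\<^sup>2) * b' + \<sigma> * D\<^sub>1 * (2 * u * v) * a'"
    have "n - 2 * h < n" using h uv by (auto simp: rep_def)
    then obtain x y where xy: "a' = u * x" "b' = v * y" "odd x" using less.IH h by blast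
    have "a = u * ((D\<^sub>1 * u\<^sup>2 - D\<^sub>2 * v\<^sup>2) * x - 2 * (\<sigma> * D\<^sub>2 * v\<^sup>2 * y))"
      using a unfolding \<mu> xy power_one mult_1 by algebra
    moreover have "b = v * ((D\<^sub>1 * u\<^sup>2 - D\<^sub>2 * v\<^sup>2) * y + 2 * \<sigma> * D\<^sub>1 * u\<^sup>2 * x)"
      using b unfolding \<mu> xy power_one mult_1 by algebra
    moreover have "odd ((D\<^sub>1 * u\<^sup>2 - D\<^sub>2 * v\<^sup>2) * x - 2 * (\<sigma> * D\<^sub>2 * v\<^sup>2 * y))"
      using s xy(3) by simp
    ultimately show ?thesis by blast
  qed
qed

text \<open>An odd divisor of a power of 2 is a unit, so the first coordinate is, up to sign, that
  of the minimal element.\<close>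

lemma rep_power_2_unique:
  assumes p: "p = 3" and "rep m (2 ^ i) b" "rep n (2 ^ j) b'"
  shows "i = j"
proof -
  obtain h u v where min: "min_rep h u v"
    using minimal_rep[OF assms(2)] by blast
  have sq: "u\<^sup>2 = (2 ^ k)\<^sup>2" if r: "rep n (2 ^ k) b" for n k b
  proof -
    obtain x where x: "2 ^ k = u * x" "odd x" using odd_quotient[OF p min r] by blast
    have "x dvd 2 ^ k" unfolding x(1) by simp
    moreover have "coprime x (2 ^ k)" using x(2) by simp
    ultimately have "is_unit x" by (metis coprime_common_divisor dvd_refl)
    then have "x\<^sup>2 = 1" by (simp add: abs_square_eq_1)
    then show ?thesis unfolding x by (simp add: power_mult_distrib)
  qed
  have "(2 ^ i :: int)\<^sup>2 = (2 ^ j)\<^sup>2" using sq[OF assms(2)] sq[OF assms(3)] by simp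
  then have "(2 ^ i :: int) = 2 ^ j" by (simp add: power2_eq_iff_nonneg)
  then show ?thesis by simp
qed

text \<open>Each descent step divides by the square of the minimal element, so every element is an
  odd power of it. The signs \<open>\<alpha>\<close> and \<open>\<beta>\<close> account for negation
  and conjugation.\<close>

lemma rep_lucas:
  assumes p: "p = 2" and min: "min_rep h u v" and "rep n a b"
  shows "\<exists>j \<alpha> \<beta>. n = h * (2 * j + 1) \<and> (\<alpha> = 1 \<or> \<alpha> = -1) \<and> (\<beta> = 1 \<or> \<beta> = -1) \<and>
    a = \<alpha> * u * lucas_re (2 ^ h) (D\<^sub>2 * v\<^sup>2) j \<and> b = \<beta> * v * lucas_im (2 ^ h) (D\<^sub>2 * v\<^sup>2) j"
  using assms(3)
proof (induction n arbitrary: a b rule: less_induct)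
  case (less n)
  define q w where "q = (2::int) ^ h" and "w = D\<^sub>2 * v\<^sup>2"
  have \<mu>: "\<mu> = 2" using p param by auto
  have h0: "h > 0" and u: "D\<^sub>1 * u\<^sup>2 = 4 * q - w"
    using repD[OF min_repD[OF min]] p \<mu> by (simp_all add: q_def w_def)
  have q: "even q" using h0 by (simp add: q_def)
  show ?case
  proof (rule descent[OF min less.prems])
    assume n: "n = h" "a\<^sup>2 = u\<^sup>2" "b\<^sup>2 = v\<^sup>2"
    obtain \<alpha> \<beta> :: int where "\<alpha> = 1 \<or> \<alpha> = -1" "a = \<alpha> * u" "\<beta> = 1 \<or> \<beta> = -1" "b = \<beta> * v"
      using n(2,3) unfolding power2_eq_iff by (metis mult_1 mult_minus1)
    then show ?thesis
      using n(1) by (intro exI[of _ 0] exI[of _ \<alpha>] exI[of _ \<beta>]) simp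
  next
    fix \<sigma> a' b'
    assume h: "2 * h < n" "rep (n - 2 * h) a' b'" "\<sigma> = 1 \<or> \<sigma> = -1"
      and a: "\<mu>\<^sup>2 * a = (D\<^sub>1 * u\<^sup>2 - D\<^sub>2 * v\<^sup>2) * a' - \<sigma> * D\<^sub>2 * (2 * u * v) * b'"
      and b: "\<mu>\<^sup>2 * b = (D\<^sub>1 * u\<^sup>2 - D\<^sub>2 * v\<^sup>2) * b' + \<sigma> * D\<^sub>1 * (2 * u * v) * a'"
    have "n - 2 * h < n" using h h0 by auto
    then obtain j \<alpha> \<beta> where j: "n - 2 * h = h * (2 * j + 1)"
      and \<alpha>: "\<alpha> = 1 \<or> \<alpha> = -1" and \<beta>: "\<beta> = 1 \<or> \<beta> = -1"
      and a': "a' = \<alpha> * u * lucas_re q w j" and b': "b' = \<beta> * v * lucas_im q w j"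
      using less.IH[of "n - 2 * h" a' b'] h unfolding q_def w_def by blast
    define R I where "R = lucas_re q w j" and "I = lucas_im q w j"
    have n: "n = h * (2 * Suc j + 1)" using j h(1) by simp
    have a2: "4 * a = 2 * u * (\<alpha> * (2 * q - w) * R - \<sigma> * \<beta> * w * I)"
      using a u unfolding \<mu> a' b' w_def[symmetric] R_def[symmetric] I_def[symmetric]
      unfolding w_def by algebra
    have b2: "4 * b = 2 * v * (\<beta> * (2 * q - w) * I + \<sigma> * \<alpha> * (4 * q - w) * R)"
      using b u unfolding \<mu> a' b' w_def[symmetric] R_def[symmetric] I_def[symmetric]
      unfolding w_def by algebra
    have step: "2 * lucas_re q w (Suc j) = (2 * q - w) * R - w * I"
      "2 * lucas_im q w (Suc j) = (2 * q - w) * I + (4 * q - w) * R"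
      unfolding R_def I_def by (rule lucas_step)+
    show ?thesis
    proof (cases "\<sigma> * \<alpha> * \<beta> = 1")
      case True
      then have "\<sigma> * \<beta> = \<alpha>" "\<sigma> * \<alpha> = \<beta>" using \<alpha> \<beta> h(3) by auto
      then have "4 * a = 2 * u * \<alpha> * (2 * lucas_re q w (Suc j))"
        "4 * b = 2 * v * \<beta> * (2 * lucas_im q w (Suc j))"
        unfolding a2 b2 step by (simp_all add: algebra_simps)
      then have "a = \<alpha> * u * lucas_re q w (Suc j)" "b = \<beta> * v * lucas_im q w (Suc j)"
        by simp_all
      then show ?thesis using n \<alpha> \<beta> unfolding q_def w_def by blast
    next
      \<comment> \<open>Here the square of the minimal element meets the conjugate of its odd power,
        and a factor \<open>q\<close> splits off. The first coordinate becomes even, against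
        primitivity.\<close>
      case False
      then have "\<sigma> * \<beta> = - \<alpha>" using \<alpha> \<beta> h(3) by auto
      then have a3: "4 * a = 2 * u * \<alpha> * ((2 * q - w) * R + w * I)"
        unfolding a2 by (simp add: algebra_simps)
      have "even a"
      proof (cases j)
        case 0
        then have "a = u * \<alpha> * q" using a3 by (simp add: R_def I_def)
        then show ?thesis using q by simp
      next
        case (Suc i)
        have "(2 * q - w) * R + w * I = 2 * ((2 * q - w) * R) - 2 * lucas_re q w (Suc j)"
          using step by simp
        also have "\<dots> = 2 * (q\<^sup>2 * lucas_re q w i)" unfolding R_def Suc by simp
        finally have "a = u * \<alpha> * (q\<^sup>2 * lucas_re q w i)" using a3 by simp
        then show ?thesis using q by simp
      qed
      then show ?thesis using repD(4)[OF less.prems] p by simp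
    qed
  qed
qed

text \<open>A second coordinate 1 makes all its factors units. If the index \<open>j\<close> is not
  1 modulo 3, the first quotient is a unit too and the element has least norm. Otherwise the element
  is a cube, and \<open>lucas_triple\<close> makes everything explicit in terms of the exponent
  \<open>H\<close> of its cube root.\<close>

lemma rep_power_3:
  assumes p: "p = 2" and min: "min_rep h u v" and n: "rep n (3 ^ i) 1" and D: "3 dvd D\<^sub>1 \<or> odd_only \<and> D\<^sub>2 mod 3 = 2"
  obtains "n = h"
  | H e \<sigma> where "H > 0" "n = 3 * H" "\<sigma> = 1 \<or> \<sigma> = -1"
      "D\<^sub>1 * 9 ^ e = 2 ^ H + \<sigma>" "D\<^sub>2 = 3 * 2 ^ H - \<sigma>" "3 ^ i = \<bar>2 ^ H - D\<^sub>2\<bar> * 3 ^ e"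
proof -
  define q w where "q = (2::int) ^ h" and "w = D\<^sub>2 * v\<^sup>2"
  have \<mu>: "\<mu> = 2" using p param by auto
  have h0: "h > 0" and u: "D\<^sub>1 * u\<^sup>2 = 4 * q - w" and hodd: "odd_only \<Longrightarrow> odd h"
    using repD[OF min_repD[OF min]] p \<mu> by (simp_all add: q_def w_def)
  obtain j \<alpha> \<beta> where j: "n = h * (2 * j + 1)"
    and \<alpha>: "\<alpha> = 1 \<or> \<alpha> = -1" and \<beta>: "\<beta> = 1 \<or> \<beta> = -1"
    and a: "3 ^ i = \<alpha> * u * lucas_re q w j" and b: "1 = \<beta> * v * lucas_im q w j"
    using rep_lucas[OF p min n] unfolding q_def w_def by blast
  have v: "v\<^sup>2 = 1" and Ij: "(lucas_im q w j)\<^sup>2 = 1"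
  proof -
    have "v dvd 1" "lucas_im q w j dvd 1" using b by (metis dvd_triv_left dvd_triv_right dvd_mult_left mult.commute)+
    then show "v\<^sup>2 = 1" "(lucas_im q w j)\<^sup>2 = 1" by (simp_all add: abs_square_eq_1)
  qed
  have wD: "w = D\<^sub>2" by (simp add: w_def v)
  have q3: "\<not> 3 dvd q"
    unfolding q_def using prime_dvd_power[of "3::int" 2 h] by auto
  \<comment> \<open>Either 3 divides \<open>D\<^sub>1\<close>, a factor of \<open>4 * q - w\<close>,
    or \<open>h\<close> is odd and both \<open>q\<close> and \<open>w\<close> are 2 modulo
    3.\<close>
  have "3 dvd 4 * q - w"
    using D
  proof
    assume "3 dvd D\<^sub>1"
    then show ?thesis unfolding u[symmetric] by simp
  next
    assume *: "odd_only \<and> D\<^sub>2 mod 3 = 2"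
    then obtain k where "h = 2 * k + 1" using hodd oddE by blast
    moreover define z where "z = (4::int) ^ k"
    ultimately have "q = 2 * z" by (simp add: q_def power_mult)
    moreover have "z mod 3 = 1" unfolding z_def by (simp add: power_mod[of 4 3 k, symmetric])
    moreover have "D\<^sub>2 mod 3 = 2" using * by simp
    ultimately show ?thesis unfolding wD by presburger
  qed
  note mod3 = lucas_re_mod_3[OF this q3]
  show thesis
  proof (cases "j mod 3 = 1")
    case False
    then have "\<not> 3 dvd lucas_re q w j" using mod3 by simp
    then have "coprime (lucas_re q w j) (3 ^ i)"
      using prime_imp_coprime[of "3::int" "lucas_re q w j"] by (simp add: coprime_commute)
    moreover have "lucas_re q w j dvd 3 ^ i" unfolding a by simp
    ultimately have "is_unit (lucas_re q w j)" by (metis coprime_common_divisor dvd_refl)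
    then have "(lucas_re q w j)\<^sup>2 = 1" by (simp add: abs_square_eq_1)
    then have "4 * q ^ (2 * j + 1) = 4 * q" using lucas_norm[of q w j] Ij by simp
    then have "2 ^ (h * (2 * j + 1)) = (2::int) ^ h" by (simp only: q_def power_mult)
    then show thesis using that(1) j by simp
  next
    case True
    then obtain l where l: "j = 3 * l + 1" by (metis mult_div_mod_eq)
    define H where "H = h * (2 * l + 1)"
    have qH: "q ^ (2 * l + 1) = 2 ^ H" by (simp only: q_def H_def power_mult)
    define R I where "R = lucas_re q w l" and "I = lucas_im q w l"
    have Rj: "lucas_re q w j = R * (2 ^ H - w * I\<^sup>2)" and Ij': "lucas_im q w j = I * (3 * 2 ^ H - w * I\<^sup>2)"
      unfolding l R_def I_def lucas_triple qH by simp_all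
    have "is_unit (lucas_im q w j)" using Ij by (simp add: abs_square_eq_1)
    then have "is_unit I" "is_unit (3 * 2 ^ H - w * I\<^sup>2)"
      unfolding Ij' by (fact dvd_mult_left, fact dvd_mult_right)
    then have I: "I\<^sup>2 = 1" and "\<bar>3 * 2 ^ H - w * I\<^sup>2\<bar> = 1"
      by (simp_all add: abs_square_eq_1)
    then have \<sigma>: "3 * 2 ^ H - D\<^sub>2 = 1 \<or> 3 * 2 ^ H - D\<^sub>2 = -1"
      unfolding I wD by auto
    have "u * R dvd 3 ^ i" unfolding a Rj by simp
    then obtain e where e: "\<bar>u * R\<bar> = 3 ^ e" using dvd_power_3_cases by blast
    have "3 ^ i = \<alpha> * (u * R) * (2 ^ H - D\<^sub>2)"
      using a[unfolded Rj I] unfolding wD by (simp only: mult.assoc mult_1_right)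
    then have "(3::int) ^ i = \<bar>\<alpha> * (u * R) * (2 ^ H - D\<^sub>2)\<bar>"
      by (metis abs_of_nonneg zero_le_numeral zero_le_power)
    also have "\<dots> = \<bar>2 ^ H - D\<^sub>2\<bar> * 3 ^ e" using \<alpha> by (auto simp: abs_mult e[unfolded abs_mult])
    finally have i: "3 ^ i = \<bar>2 ^ H - D\<^sub>2\<bar> * 3 ^ e" .
    have "(9::int) ^ e = (u * R)\<^sup>2"
      unfolding power2_abs[of "u * R", symmetric] e by (simp add: power2_eq_square flip: power_mult_distrib)
    then have "D\<^sub>1 * 9 ^ e = (D\<^sub>1 * u\<^sup>2) * R\<^sup>2" by (simp add: power_mult_distrib)
    also have "\<dots> = 4 * 2 ^ H - D\<^sub>2"
      using lucas_norm[of q w l, folded R_def I_def, unfolded qH I] unfolding u wD by simp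
    finally have "D\<^sub>1 * 9 ^ e = 2 ^ H + (3 * 2 ^ H - D\<^sub>2)" by simp
    moreover have "n = 3 * H" by (simp add: j l H_def algebra_simps)
    moreover have "H > 0" using h0 by (simp add: H_def)
    ultimately show thesis using that(2)[of H "3 * 2 ^ H - D\<^sub>2" e] \<sigma> i by simp
  qed
qed

end

section \<open>Pillai's equation\<close>

lemma not_3_dvd_power_2: "\<not> (3::int) dvd 2 ^ n"
  using prime_dvd_power[of "3::int" 2 n] by auto

lemma power_2_mod_3: "(2::int) ^ n mod 3 = (if even n then 1 else 2)"
proof (induction n)
  case (Suc n)
  have "(2::int) ^ Suc n mod 3 = 2 * (2 ^ n mod 3) mod 3" by (simp add: mod_mult_right_eq)
  then show ?case unfolding Suc.IH by simp
qed simp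

lemma power_3_mod_4: "(3::int) ^ n mod 4 = (if even n then 1 else 3)"
proof (induction n)
  case (Suc n)
  have "(3::int) ^ Suc n mod 4 = 3 * (3 ^ n mod 4) mod 4" by (simp add: mod_mult_right_eq)
  then show ?case unfolding Suc.IH by simp
qed simp

lemma power_3_mod_8: "(3::int) ^ n mod 8 = (if even n then 1 else 3)"
proof (induction n)
  case (Suc n)
  have "(3::int) ^ Suc n mod 8 = 3 * (3 ^ n mod 8) mod 8" by (simp add: mod_mult_right_eq)
  then show ?case unfolding Suc.IH by simp
qed simp

section \<open>Pillai's equation with even exponents\<close>

text \<open>Put \<open>t = 2 ^ (y' - y)\<close>. As a difference of squares, the common value is at
  least \<open>3 ^ x' + 2 ^ y' > 2 * t\<close>. But \<open>3 ^ (2 * x)\<close> divides one of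
  \<open>t - 1\<close> and \<open>t + 1\<close>, so the value is below \<open>t + 1\<close>.\<close>

lemma even_power_diff_pos:
  assumes eq: "(3::int) ^ (2 * x) - 2 ^ (2 * y) = 3 ^ (2 * x') - 2 ^ (2 * y')"
    and pos: "(3::int) ^ (2 * x) > 2 ^ (2 * y)" and y: "y < y'"
  shows False
proof -
  define d where "d = y' - y"
  define t where "t = (2::int) ^ d"
  have t: "t > 0" "2 ^ y' = t * 2 ^ y" "2 ^ (2 * y') = t\<^sup>2 * 2 ^ (2 * y)"
    using y by (auto simp: t_def d_def power_mult_distrib simp flip: power_add power_mult)
  have gt: "(2::int) ^ (2 * y') > 2 ^ (2 * y)" using y by simp
  then have "(3::int) ^ (2 * x') > 3 ^ (2 * x)" using eq by linarith
  then have x: "x < x'" by simp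
  define s where "s = (3::int) ^ (2 * (x' - x)) - 1"
  have "(3::int) ^ (2 * x') = 3 ^ (2 * x) * 3 ^ (2 * (x' - x))"
    using x by (simp flip: power_add)
  then have "(t\<^sup>2 - 1) * 2 ^ (2 * y) = 3 ^ (2 * x) * s"
    using eq t(3) by (simp add: s_def algebra_simps)
  then have "(3::int) ^ (2 * x) dvd (t\<^sup>2 - 1) * 2 ^ (2 * y)" by simp
  moreover have "coprime ((3::int) ^ (2 * x)) (2 ^ (2 * y))" by simp
  ultimately have "(3::int) ^ (2 * x) dvd t\<^sup>2 - 1" by (simp add: coprime_dvd_mult_left_iff)
  then obtain k where k: "t\<^sup>2 - 1 = 3 ^ (2 * x) * k" by blast
  then have k': "(t - 1) * (t + 1) = 3 ^ (2 * x) * k" by (simp add: algebra_simps power2_eq_square)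
  have "\<not> (3::int) dvd 2 ^ Suc d" by (rule not_3_dvd_power_2)
  then have nd: "\<not> 3 dvd (t - 1) + (t + 1)" by (simp add: t_def)
  have t2: "t \<ge> 2" using y unfolding t_def d_def by (simp add: self_le_power)
  have "3 ^ (2 * x) \<le> t + 1"
  proof (rule prime_power_split[OF _ k' nd])
    fix z assume "t - 1 = 3 ^ (2 * x) * z"
    then have "3 ^ (2 * x) \<le> t - 1" using t2 by (intro zdvd_imp_le) auto
    then show ?thesis by simp
  next
    fix z assume "t + 1 = 3 ^ (2 * x) * z"
    then show ?thesis using t2 by (intro zdvd_imp_le) auto
  qed simp
  moreover have "(2::int) ^ y' + 3 ^ x' \<le> 3 ^ (2 * x') - 2 ^ (2 * y')"
  proof -
    have f: "(3::int) ^ (2 * x') - 2 ^ (2 * y') = (3 ^ x' - 2 ^ y') * (2 ^ y' + 3 ^ x')"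
      by (simp only: power_even_eq power2_eq_square) (simp add: algebra_simps)
    moreover have "(3::int) ^ (2 * x') - 2 ^ (2 * y') > 0" using eq pos by linarith
    ultimately have "1 \<le> (3::int) ^ x' - 2 ^ y'"
      by (metis add_pos_pos zero_less_mult_pos2 zero_less_numeral zero_less_power int_one_le_iff_zero_less)
    then have "1 * (2 ^ y' + 3 ^ x') \<le> ((3::int) ^ x' - 2 ^ y') * (2 ^ y' + 3 ^ x')"
      by (rule mult_right_mono) simp
    then show ?thesis unfolding f by simp
  qed
  moreover have "(3::int) ^ x' > 2 ^ y'"
  proof -
    have "((2::int) ^ y')\<^sup>2 < (3 ^ x')\<^sup>2" using eq pos by (simp add: power_even_eq)
    then show ?thesis by (rule power_less_imp_less_base) simp
  qed
  moreover have "(2::int) ^ y' \<ge> t" unfolding t(2) using t(1) by (simp add: mult_le_cancel_left1)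
  moreover have "(2::int) ^ (2 * y) > 0" by simp
  ultimately show False using eq t2 by linarith
qed

text \<open>The same size argument with 2 and 3 exchanged. Now \<open>t = 3 ^ (x' - x)\<close> is
  odd, so it is applied to the halves \<open>r\<close> and \<open>r + 1\<close> of
  \<open>t - 1\<close> and \<open>t + 1\<close>.\<close>

lemma even_power_diff_neg:
  assumes eq: "(2::int) ^ (2 * y) - 3 ^ (2 * x) = 2 ^ (2 * y') - 3 ^ (2 * x')"
    and pos: "(2::int) ^ (2 * y) > 3 ^ (2 * x)" and x: "x < x'" "x > 0"
  shows False
proof -
  define d where "d = x' - x"
  define t where "t = (3::int) ^ d"
  have t: "t > 0" "3 ^ x' = t * 3 ^ x" "3 ^ (2 * x') = t\<^sup>2 * 3 ^ (2 * x)"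
    using x by (auto simp: t_def d_def power_mult_distrib simp flip: power_add power_mult)
  have gt: "(3::int) ^ (2 * x') > 3 ^ (2 * x)" using x by simp
  then have "(2::int) ^ (2 * y') > 2 ^ (2 * y)" using eq by linarith
  then have y: "y < y'" by simp
  have "(3::int) ^ (2 * x) \<ge> 1" by simp
  then have "y \<noteq> 0" using pos by (intro notI) (simp del: one_le_power)
  then have y0: "y > 0" by simp
  define s where "s = (2::int) ^ (2 * (y' - y)) - 1"
  have "(2::int) ^ (2 * y') = 2 ^ (2 * y) * 2 ^ (2 * (y' - y))"
    using y by (simp flip: power_add)
  then have "(t\<^sup>2 - 1) * 3 ^ (2 * x) = 2 ^ (2 * y) * s"
    using eq t(3) by (simp add: s_def algebra_simps)
  then have "(2::int) ^ (2 * y) dvd (t\<^sup>2 - 1) * 3 ^ (2 * x)" by simp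
  moreover have "coprime ((2::int) ^ (2 * y)) (3 ^ (2 * x))" by simp
  ultimately have "(2::int) ^ (2 * y) dvd t\<^sup>2 - 1" by (simp add: coprime_dvd_mult_left_iff)
  then obtain k where k: "t\<^sup>2 - 1 = 2 ^ (2 * y) * k" by blast
  have odd: "odd t" by (simp add: t_def)
  then obtain r where r: "t = 2 * r + 1" by (elim oddE)
  define m where "m = 2 * y - 2"
  have m: "(2::int) ^ (2 * y) = 4 * 2 ^ m" using y0 unfolding m_def by (cases y) auto
  have r2: "r * (r + 1) = 2 ^ m * k" using k unfolding m r by (simp add: algebra_simps power2_eq_square)
  have nd: "\<not> 2 dvd r + (r + 1)" by simp
  have t3: "t \<ge> 3" using x unfolding t_def d_def by (simp add: self_le_power)
  have "2 ^ m \<le> r + 1"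
  proof (rule prime_power_split[OF _ r2 nd])
    fix z assume "r = 2 ^ m * z"
    then have "2 ^ m \<le> r" using t3 r by (intro zdvd_imp_le) auto
    then show ?thesis by simp
  next
    fix z assume "r + 1 = 2 ^ m * z"
    then show ?thesis using t3 r by (intro zdvd_imp_le) auto
  qed simp
  moreover have "(2::int) ^ y' + 3 ^ x' \<le> 2 ^ (2 * y') - 3 ^ (2 * x')"
  proof -
    have f: "(2::int) ^ (2 * y') - 3 ^ (2 * x') = (2 ^ y' - 3 ^ x') * (2 ^ y' + 3 ^ x')"
      by (simp only: power_even_eq power2_eq_square) (simp add: algebra_simps)
    moreover have "(2::int) ^ (2 * y') - 3 ^ (2 * x') > 0" using eq pos by linarith
    ultimately have "1 \<le> (2::int) ^ y' - 3 ^ x'"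
      by (metis add_pos_pos zero_less_mult_pos2 zero_less_numeral zero_less_power int_one_le_iff_zero_less)
    then have "1 * (2 ^ y' + 3 ^ x') \<le> ((2::int) ^ y' - 3 ^ x') * (2 ^ y' + 3 ^ x')"
      by (rule mult_right_mono) simp
    then show ?thesis unfolding f by simp
  qed
  moreover have "(2::int) ^ y' > 3 ^ x'"
  proof -
    have "((3::int) ^ x')\<^sup>2 < (2 ^ y')\<^sup>2" using eq pos by (simp add: power_even_eq)
    then show ?thesis by (rule power_less_imp_less_base) simp
  qed
  moreover have "(3::int) ^ x' \<ge> 3 * t"
  proof -
    have "(3::int) ^ x \<ge> 3" using x by (simp add: self_le_power)
    then show ?thesis unfolding t(2) using t(1) by simp
  qed
  moreover have "(3::int) ^ (2 * x) > 0" by simp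
  ultimately show False using eq t3 r m by linarith
qed

section \<open>Pillai's equation according to the sign of the common difference\<close>

text \<open>Modulo 3, and modulo 4 for even \<open>y\<close>, the parities agree in both solutions.
  Unless both exponents are even, \<open>3 ^ x\<close> is a value of
  \<open>2 * a\<^sup>2 + k * b\<^sup>2\<close> or \<open>a\<^sup>2 + k * b\<^sup>2\<close> with
  \<open>a\<close> a power of 2, and \<open>rep_power_2_unique\<close> applies.\<close>

lemma pillai_pos:
  fixes k :: int
  assumes k: "k > 1" "3 ^ x - 2 ^ y = k" "3 ^ x' - 2 ^ y' = k"
    and pos: "x > 0" "y > 0" "x' > 0" "y' > 0"
  shows "y = y'"
proof -
  have "(3::int) dvd 3 ^ x" "(3::int) dvd 3 ^ x'" using pos by (simp_all add: dvd_power)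
  then have "(3::int) dvd 3 ^ x - 3 ^ x'" by (rule dvd_diff)
  then have "(2::int) ^ y mod 3 = 2 ^ y' mod 3" using k(2,3) unfolding mod_eq_dvd_iff by (simp add: algebra_simps)
  then have par: "even y \<longleftrightarrow> even y'" unfolding power_2_mod_3 by (auto split: if_splits)
  have k3: "\<not> 3 dvd k"
    using \<open>3 dvd 3 ^ x\<close> k(2) not_3_dvd_power_2 by (metis dvd_diff_right_iff)
  show ?thesis
  proof (cases "even y")
    case False
    then obtain i j where ij: "y = 2 * i + 1" "y' = 2 * j + 1" using par by (meson oddE)
    interpret norm_form 2 k 1 3 False
    proof
      fix a b :: int
      show "2 * a\<^sup>2 + k * b\<^sup>2 \<noteq> 1\<^sup>2"
      proof (cases "b = 0")
        case True then show ?thesis by simp presburger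
      next
        case False
        then have "b\<^sup>2 \<ge> 1" by (smt (verit) zero_less_power2)
        then have "k * 1 \<le> k * b\<^sup>2" using k(1) by (intro mult_left_mono) auto
        then have "2 * a\<^sup>2 + k * b\<^sup>2 > 1" using k(1) zero_le_power2[of a] by linarith
        then show ?thesis by simp
      qed
    qed (use k k3 in auto)
    have "rep x (2 ^ i) 1" "rep x' (2 ^ j) 1"
      using k pos unfolding rep_def ij by (auto simp: not_3_dvd_power_2 power_even_eq)
    then show ?thesis using rep_power_2_unique ij by blast
  next
    case True
    then obtain i j where ij: "y = 2 * i" "y' = 2 * j" using par by (meson evenE)
    have "(4::int) dvd 2 ^ y" "(4::int) dvd 2 ^ y'"
      using pos ij le_imp_power_dvd[of 2 y "2::int"] le_imp_power_dvd[of 2 y' "2::int"] by auto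
    then have "(4::int) dvd 2 ^ y - 2 ^ y'" by (rule dvd_diff)
    then have "(3::int) ^ x mod 4 = 3 ^ x' mod 4"
      using k(2,3) unfolding mod_eq_dvd_iff by (simp add: algebra_simps)
    then have parx: "even x \<longleftrightarrow> even x'" unfolding power_3_mod_4 by (auto split: if_splits)
    show ?thesis
    proof (cases "even x")
      case True
      then obtain r s where rs: "x = 2 * r" "x' = 2 * s" using parx by (meson evenE)
      show ?thesis
      proof (rule linorder_cases[of i j])
        assume "i < j" then show ?thesis using even_power_diff_pos[of r i s j] k ij rs by auto
      next
        assume "j < i" then show ?thesis using even_power_diff_pos[of s j r i] k ij rs by auto
      qed (simp add: ij)
    next
      case False
      interpret norm_form 1 k 1 3 True
        by unfold_locales (use k k3 in auto)
      have "rep x (2 ^ i) 1" "rep x' (2 ^ j) 1"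
        using k pos False parx unfolding rep_def ij by (auto simp: not_3_dvd_power_2 power_even_eq)
      then show ?thesis using rep_power_2_unique ij by blast
    qed
  qed
qed

text \<open>Now the norms are powers of 2, and by \<open>rep_power_3\<close> two solutions can
  coexist only if one is a cube. This is impossible for even \<open>x\<close> and gives the listed
  solutions for odd \<open>x\<close>.\<close>

lemma pillai_neg:
  fixes k :: int
  assumes k: "k > 0" "2 ^ y - 3 ^ x = k" "2 ^ y' - 3 ^ x' = k"
    and pos: "x > 0" "y > 0" "x' > 0" and less: "y < y'"
  shows "(x = 1 \<and> y = 3 \<and> x' = 3 \<and> y' = 5) \<or> (x = 1 \<and> y = 4 \<and> x' = 5 \<and> y' = 8)"
proof -
  have "(3::int) ^ 1 \<le> 3 ^ x" "(3::int) ^ 1 \<le> 3 ^ x'" using pos by (intro power_increasing; simp)+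
  then have "(2::int) ^ y > 2" using k by simp
  then have y2: "y \<ge> 2" using pos by (cases "y = 1") auto
  have "(2::int) ^ y < 2 ^ y'" using less by simp
  then have "(3::int) ^ x < 3 ^ x'" using k by linarith
  then have xx: "x < x'" by simp
  have ok: "odd k" using pos k(2) by auto
  have "(4::int) dvd 2 ^ y" "(4::int) dvd 2 ^ y'"
    using y2 less le_imp_power_dvd[of 2 y "2::int"] le_imp_power_dvd[of 2 y' "2::int"] by auto
  then have "(4::int) dvd 2 ^ y - 2 ^ y'" by (rule dvd_diff)
  then have "(3::int) ^ x mod 4 = 3 ^ x' mod 4" using k(2,3) unfolding mod_eq_dvd_iff by (simp add: algebra_simps)
  then have parx: "even x \<longleftrightarrow> even x'" unfolding power_3_mod_4 by (auto split: if_splits)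
  have "(3::int) dvd 3 ^ x" "(3::int) dvd 3 ^ x'" using pos by (simp_all add: dvd_power)
  moreover have "k - 2 ^ y = - (3 ^ x)" "k - 2 ^ y' = - (3 ^ x')" using k(2,3) by simp_all
  ultimately have m3: "k mod 3 = 2 ^ y mod 3" "k mod 3 = 2 ^ y' mod 3"
    unfolding mod_eq_dvd_iff by simp_all
  then have par: "even y \<longleftrightarrow> even y'" unfolding power_2_mod_3 by (auto split: if_splits)
  show ?thesis
  proof (cases "even x")
    case True
    then obtain i j where ij: "x = 2 * i" "x' = 2 * j" using parx by (meson evenE)
    show ?thesis
    proof (cases "even y")
      case True
      then obtain r s where rs: "y = 2 * r" "y' = 2 * s" using par by (meson evenE)
      then show ?thesis using even_power_diff_neg[of r i s j] k ij xx pos by auto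
    next
      case False
      have k2: "k mod 3 = 2" using m3 False unfolding power_2_mod_3 by simp
      have y3: "y \<ge> 3" using y2 False by (cases "y = 2") auto
      have "(8::int) dvd 2 ^ y" using y3 le_imp_power_dvd[of 3 y "2::int"] by simp
      moreover have "(3::int) ^ x mod 8 = 1" using \<open>even x\<close> unfolding power_3_mod_8 by simp
      \<comment> \<open>This residue yields \<open>k > 4\<close>, as \<open>D_large\<close> requires
        for \<open>\<mu> = 2\<close>.\<close>
      ultimately have "k mod 8 = 7" using k(2) by presburger
      then have k4: "k > 4" using k(1) by (smt (verit) mod_pos_pos_trivial)
      interpret norm_form 1 k 2 2 True
        by unfold_locales (use k4 ok in auto)
      have e: "(2::int) ^ n = 4 * 2 ^ (n - 2)" if "n \<ge> 2" for n
        using that by (metis power_add le_add_diff_inverse power2_eq_square mult_2 numeral_Bit0)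
      \<comment> \<open>The norm equation carries the factor \<open>\<mu>\<^sup>2 = 4\<close>, so
        \<open>2 ^ y\<close> has exponent \<open>y - 2\<close>.\<close>
      have rep1: "rep (y - 2) (3 ^ i) 1" and rep2: "rep (y' - 2) (3 ^ j) 1"
        using k pos False par y3 less e[of y] e[of y'] unfolding rep_def ij by (auto simp: power_even_eq)
      obtain h u v where min: "min_rep h u v" using minimal_rep[OF rep1] by blast
      have "n = h" if r: "rep n (3 ^ l) 1" for n l
      proof (rule rep_power_3[OF refl min r])
        fix H e \<sigma>
        assume H: "H > 0" "n = 3 * H" and \<sigma>: "\<sigma> = 1 \<or> \<sigma> = -1"
          and 9: "1 * 9 ^ e = 2 ^ H + \<sigma>" and D: "k = 3 * 2 ^ H - \<sigma>"
          and l: "3 ^ l = \<bar>2 ^ H - k\<bar> * 3 ^ e"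
        have "e > 0"
        proof (rule ccontr)
          assume "\<not> e > 0"
          then have "(1::int) = 2 ^ H + \<sigma>" using 9 by simp
          moreover have "(2::int) ^ H \<ge> 2" using H by (simp add: self_le_power)
          ultimately have "k = 7" using \<sigma> D by auto
          then show False using k2 by simp
        qed
        then obtain f where f: "e = Suc f" using gr0_implies_Suc by blast
        define g where "g = (9::int) ^ f"
        have g: "g \<ge> 1" by (simp add: g_def)
        \<comment> \<open>Substitute \<open>2 ^ H = 9 * g - \<sigma>\<close>. Then
          \<open>6 * g - \<sigma>\<close> would be a power of 3, yet it is prime to 3 and exceeds
          1.\<close>
        have "2 ^ H - k = - (3 * (6 * g - \<sigma>))" using 9 D f by (simp add: g_def)
        then have "\<bar>2 ^ H - k\<bar> = 3 * (6 * g - \<sigma>)" using g \<sigma> by auto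
        then have "6 * g - \<sigma> dvd 3 ^ l" unfolding l
          by (metis dvd_triv_right dvd_mult2)
        then obtain m where m: "\<bar>6 * g - \<sigma>\<bar> = 3 ^ m" using dvd_power_3_cases by blast
        show "n = h"
        proof (cases m)
          case 0 then show ?thesis using m g \<sigma> by auto
        next
          case (Suc m')
          then have "3 dvd \<bar>6 * g - \<sigma>\<bar>" using m by simp
          then have "3 dvd 6 * g - \<sigma>" by simp
          then show ?thesis using \<sigma> by presburger
        qed
      qed (use k2 in auto)
      then have "y - 2 = y' - 2" using rep1 rep2 by metis
      then show ?thesis using less y2 by simp
    qed
  next
    case False
    then obtain i j where ij: "x = 2 * i + 1" "x' = 2 * j + 1" using parx by (meson oddE)
    \<comment> \<open>A failure of either inequality gives \<open>k \<le> 1\<close>, while the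
      second solution shows that \<open>k\<close> is 5 modulo 8.\<close>
    have y3: "y \<ge> 3 \<and> k > 1"
    proof (rule ccontr)
      assume a: "\<not> (y \<ge> 3 \<and> k > 1)"
      have "(8::int) dvd 2 ^ y'" using y2 less le_imp_power_dvd[of 3 y' "2::int"] by simp
      moreover have "(3::int) ^ x' mod 8 = 3" using False parx unfolding power_3_mod_8 by simp
      ultimately have "k mod 8 = 5" using k(3) by presburger
      moreover have "k \<le> 1"
      proof (cases "y = 2")
        case True then show ?thesis using k(2) \<open>3 ^ 1 \<le> 3 ^ x\<close> by simp
      next
        case False then show ?thesis using a y2 by linarith
      qed
      ultimately show False using k(1) by simp
    qed
    interpret norm_form 3 k 2 2 False
    proof
      fix a b :: int
      show "3 * a\<^sup>2 + k * b\<^sup>2 \<noteq> 2\<^sup>2"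
      proof
        assume *: "3 * a\<^sup>2 + k * b\<^sup>2 = 2\<^sup>2"
        have b: "b\<^sup>2 \<noteq> 0"
        proof
          assume "b\<^sup>2 = 0"
          then have "3 * a\<^sup>2 = 4" using * by simp
          then show False by presburger
        qed
        then have "b\<^sup>2 \<ge> 1" using zero_le_power2[of b] by linarith
        then have "k * 1 \<le> k * b\<^sup>2" using k(1) by (intro mult_left_mono) auto
        moreover have "k \<ge> 3" using y3 ok by (cases "k = 2") auto
        moreover have "3 * a\<^sup>2 + k * b\<^sup>2 = 4" using * by simp
        ultimately have "a\<^sup>2 = 0" using zero_le_power2[of a] by linarith
        then have 4: "k * b\<^sup>2 = 4" using * by simp
        then have "k dvd 2 ^ 2" by (metis dvd_triv_left numeral_Bit0 mult_2 power2_eq_square)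
        moreover have "coprime k (2 ^ 2)" using ok by (simp only: coprime_power_right_iff coprime_right_2_iff_odd) simp
        ultimately have "is_unit k" by (metis coprime_common_divisor dvd_refl)
        then show False using \<open>k \<ge> 3\<close> by simp
      qed
    qed (use y3 ok in auto)
    have e: "(2::int) ^ n = 4 * 2 ^ (n - 2)" if "n \<ge> 2" for n
      using that by (metis power_add le_add_diff_inverse power2_eq_square mult_2 numeral_Bit0)
    have rep1: "rep (y - 2) (3 ^ i) 1" and rep2: "rep (y' - 2) (3 ^ j) 1"
      using k pos False par y3 less e[of y] e[of y'] unfolding rep_def ij by (auto simp: power_even_eq)
    obtain h u v where min: "min_rep h u v" using minimal_rep[OF rep1] by blast
    have "h \<le> y - 2" using min rep1 unfolding min_rep_def by blast
    \<comment> \<open>The larger solution is not minimal, hence it is a cube.\<close>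
    then have ne: "y' - 2 \<noteq> h" using less y3 by linarith
    obtain H e \<sigma> where H: "H > 0" "y' - 2 = 3 * H" and \<sigma>: "\<sigma> = 1 \<or> \<sigma> = -1"
      and 9: "3 * 9 ^ e = 2 ^ H + \<sigma>" and D: "k = 3 * 2 ^ H - \<sigma>"
      and l: "3 ^ j = \<bar>2 ^ H - k\<bar> * 3 ^ e"
      by (rule rep_power_3[OF refl min rep2]) (use ne in auto)
    \<comment> \<open>Otherwise \<open>2 ^ H + \<sigma>\<close> is 1 or 7 modulo 8, whereas an odd
      power of 3 is 3.\<close>
    have "H < 3"
    proof (rule ccontr)
      assume "\<not> H < 3"
      then have "(8::int) dvd 2 ^ H" using le_imp_power_dvd[of 3 H "2::int"] by simp
      moreover have "(3::int) * 9 ^ e = 3 ^ (2 * e + 1)" by (simp add: power_mult)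
      then have "(3::int) * 9 ^ e mod 8 = 3" using power_3_mod_8[of "2 * e + 1"] by simp
      ultimately show False using 9 \<sigma> by presburger
    qed
    have e0: "e = 0"
    proof (rule ccontr)
      assume "e \<noteq> 0"
      then have "(9::int) ^ e \<ge> 9" by (simp add: self_le_power)
      moreover have "(2::int) ^ H \<le> 2 ^ 2" using \<open>H < 3\<close> by (intro power_increasing) auto
      ultimately show False using 9 \<sigma> by auto
    qed
    \<comment> \<open>From \<open>3 = 2 ^ H + \<sigma>\<close>, the two cases are
      \<open>k = 5\<close>, with 8 - 3 = 32 - 27, and \<open>k = 13\<close>, with 16 - 3 = 256 -
      243.\<close>
    consider "H = 1" | "H = 2" using H \<open>H < 3\<close> by linarith
    then show ?thesis
    proof cases
      case 1
      then have "k = 5" "y' = 5" "(3::int) ^ j = 3 ^ 1" using 9 D e0 l H by auto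
      then have "j = 1" by (metis power_inject_exp one_less_numeral_iff semiring_norm(77))
      then have i: "i = 0" using ij xx by simp
      then have "(2::int) ^ y = 2 ^ 3" using k(2) \<open>k = 5\<close> ij by simp
      then have "y = 3" by (metis power_inject_exp one_less_numeral_iff semiring_norm(76))
      then show ?thesis using ij i \<open>j = 1\<close> \<open>y' = 5\<close> by simp
    next
      case 2
      then have "k = 13" "y' = 8" "(3::int) ^ j = 3 ^ 2" using 9 D e0 l H by auto
      then have "j = 2" by (metis power_inject_exp one_less_numeral_iff semiring_norm(77))
      then have "i = 0 \<or> i = 1" using ij xx by auto
      moreover have "i \<noteq> 1"
      proof
        assume "i = 1"
        then have "(2::int) ^ y = 40" using k(2) \<open>k = 13\<close> ij by (simp add: numeral_3_eq_3)
        moreover have "(2::int) ^ y \<le> 2 ^ 5 \<or> (2::int) ^ y \<ge> 2 ^ 6"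
          by (cases "y \<le> 5") (simp_all only: power_increasing_iff, auto)
        ultimately show False by simp
      qed
      ultimately have i: "i = 0" by simp
      then have "(2::int) ^ y = 2 ^ 4" using k(2) \<open>k = 13\<close> ij by simp
      then have "y = 4" by (metis power_inject_exp one_less_numeral_iff semiring_norm(76))
      then show ?thesis using ij i \<open>j = 2\<close> \<open>y' = 8\<close> by simp
    qed
  qed
qed

text \<open>For \<open>y > 1\<close> residues modulo 4 make \<open>x\<close> even. With
  \<open>3 ^ t = 2 * r + 1\<close> the equation becomes \<open>r * (r + 1) = 2 ^ m\<close>, so
  \<open>r = 1\<close>.\<close>

lemma power_3_eq_power_2_plus_1:
  assumes eq: "(3::int) ^ x = 2 ^ y + 1" and y: "y > 0"
  shows "(x = 1 \<and> y = 1) \<or> (x = 2 \<and> y = 3)"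
proof (cases "y = 1")
  case True
  then have "(3::int) ^ x = 3 ^ 1" using eq by simp
  then show ?thesis using True by (simp only: power_inject_exp) simp
next
  case False
  define m where "m = y - 2"
  have m: "y = m + 2" using y False by (simp add: m_def)
  have m': "(2::int) ^ y = 2 ^ m * 4" by (simp add: m)
  have "(3::int) ^ x mod 4 = 1" unfolding eq m' by simp
  then have "even x" unfolding power_3_mod_4 by (simp split: if_splits)
  then obtain t where t: "x = 2 * t" by (elim evenE)
  have "odd ((3::int) ^ t)" by simp
  then obtain r where r: "(3::int) ^ t = 2 * r + 1" by (elim oddE)
  have r0: "r > 0"
  proof -
    have "(3::int) ^ x > 1" unfolding eq by simp
    then have "t \<noteq> 0" using t by (intro notI) simp
    then have "(3::int) ^ t \<ge> 3" by (simp add: self_le_power)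
    then show ?thesis using r by linarith
  qed
  have "(2 * r + 1)\<^sup>2 = 2 ^ m * 4 + 1" using eq unfolding t m' r[symmetric] by (simp add: power_even_eq)
  then have r2: "r * (r + 1) = 2 ^ m * 1" by (simp add: power2_eq_square algebra_simps)
  have nd: "\<not> 2 dvd r + (r + 1)" by simp
  have "2 ^ m \<le> r + 1"
  proof (rule prime_power_split[OF _ r2 nd])
    fix z assume "r = 2 ^ m * z"
    then have "2 ^ m \<le> r" using r0 by (intro zdvd_imp_le) auto
    then show ?thesis by simp
  next
    fix z assume "r + 1 = 2 ^ m * z"
    then show ?thesis using r0 by (intro zdvd_imp_le) auto
  qed simp
  then have "r * (r + 1) \<le> 1 * (r + 1)" using r2 by simp
  then have "r \<le> 1" using r0 by (intro mult_right_le_imp_le[of r "r + 1" 1]) auto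
  then have "r = 1" using r0 by simp
  then have "(3::int) ^ t = 3 ^ 1" "(2::int) ^ m = 2 ^ 1" using r r2 by simp_all
  then have "t = 1" "m = 1" by (simp_all only: power_inject_exp) 
  then show ?thesis using t m by simp
qed

text \<open>Rearranged, \<open>3 ^ c - 2 ^ f = 3 ^ a - 2 ^ e\<close> has an odd value
  \<open>k\<close>. There are no two solutions for \<open>k > 1\<close>; \<open>k = 1\<close> gives
  9 - 3, and \<open>k < 0\<close> gives 27 - 3 and 243 - 3.\<close>

lemma pillai:
  assumes eq: "(3::int) ^ a - 3 ^ c = 2 ^ e - 2 ^ f"
    and c: "c > 0" "c < a" and f: "f > 0" "f < e"
  shows "(3::int) ^ a - 3 ^ c \<in> {6, 24, 240}"
proof -
  define k where "k = (3::int) ^ c - 2 ^ f"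
  have k: "3 ^ c - 2 ^ f = k" "3 ^ a - 2 ^ e = k" using eq by (simp_all add: k_def)
  have "odd k" using k(1) f by auto
  then consider "k > 1" | "k = 1" | "k < 0" by (metis even_zero linorder_cases int_one_le_iff_zero_less order_le_less)
  then show ?thesis
  proof cases
    case 1
    then have "f = e" using pillai_pos[of k c f a e] k c f by simp
    then show ?thesis using f by simp
  next
    case 2
    then have "(3::int) ^ c = 2 ^ f + 1" "(3::int) ^ a = 2 ^ e + 1" using k by simp_all
    then have "(c = 1 \<and> f = 1) \<or> (c = 2 \<and> f = 3)" "(a = 1 \<and> e = 1) \<or> (a = 2 \<and> e = 3)"
      using power_3_eq_power_2_plus_1[of c f] power_3_eq_power_2_plus_1[of a e] f by simp_all
    then have "c = 1" "a = 2" using c by linarith+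
    then show ?thesis by simp
  next
    case 3
    then have "(c = 1 \<and> f = 3 \<and> a = 3 \<and> e = 5) \<or> (c = 1 \<and> f = 4 \<and> a = 5 \<and> e = 8)"
      using pillai_neg[of "- k" f c e a] k c f by simp
    then show ?thesis by auto
  qed
qed

section \<open>Numbers that are not differences of harmonic numbers\<close>

lemma ndh_iff: "ndh x \<longleftrightarrow> x > 0 \<and> (\<forall>a b c d. 2 ^ a * 3 ^ b \<noteq> 2 ^ c * 3 ^ d + x)"
proof -
  have "int x = int h - int k \<longleftrightarrow> h = k + x" for h k by linarith
  then have "(\<exists>h k. harmonic h \<and> harmonic k \<and> int x = int h - int k) \<longleftrightarrow>
      (\<exists>a b c d. 2 ^ a * 3 ^ b = 2 ^ c * 3 ^ d + x)"
    unfolding harmonic_def by metis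
  then show ?thesis unfolding ndh_def by blast
qed

text \<open>The two terms have opposite parity and are not both multiples of 3. Congruences leave
  \<open>3 ^ b = 2 ^ c + p\<close> with even exponents. Factoring \<open>p\<close> as a difference
  of squares gives \<open>3 ^ s = 2 ^ t + 1\<close>, impossible modulo 4 as \<open>s\<close> is
  odd.\<close>

lemma ndh_prime:
  assumes p: "prime p" "[p = 41] (mod 48)"
  shows "ndh p"
proof -
  have "p mod 48 = 41" using p(2) by (simp add: cong_def)
  then obtain m where m: "p = 48 * m + 41" by (metis mult_div_mod_eq)
  have False if eq: "2 ^ a * 3 ^ b = 2 ^ c * 3 ^ d + p" for a b c d
  proof -
    have "even ((2::nat) ^ a * 3 ^ b) \<longleftrightarrow> odd ((2::nat) ^ c * 3 ^ d)" unfolding eq m by simp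
    then have ac: "a = 0 \<longleftrightarrow> c \<noteq> 0" by auto
    have bd: "b = 0 \<or> d = 0"
    proof (rule ccontr)
      assume "\<not> (b = 0 \<or> d = 0)"
      then have "(3::nat) dvd 2 ^ a * 3 ^ b" "(3::nat) dvd 2 ^ c * 3 ^ d"
        by (simp_all add: dvd_power)
      then have "3 dvd p" unfolding eq by (simp add: dvd_add_right_iff)
      then show False unfolding m by presburger
    qed
    have eqi: "(2::int) ^ a * 3 ^ b = 2 ^ c * 3 ^ d + int p"
      using arg_cong[OF eq, of int] by simp
    show False
    proof (cases "a = 0")
      case False
      then have c: "c = 0" using ac by simp
      show False
      proof (cases "d = 0")
        case True
        then have e: "(2::int) ^ a * 3 ^ b = 48 * int m + 42" using eqi c m by simp
        have "a = 1"
        proof (rule ccontr)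
          assume "a \<noteq> 1"
          then have "(2::int) ^ 2 dvd 2 ^ a" using False by (intro le_imp_power_dvd) auto
          then have "4 dvd (2::int) ^ a * 3 ^ b" by simp
          then show False unfolding e by presburger
        qed
        then have "(3::int) ^ b = 24 * int m + 21" using e by simp
        then have "(3::int) ^ b mod 8 = 5" by presburger
        then show False unfolding power_3_mod_8 by (simp split: if_splits)
      next
        case False
        then have e: "(2::int) ^ a = 3 ^ d + (48 * int m + 41)" using eqi bd c m by simp
        have "a \<ge> 3"
        proof (rule ccontr)
          assume "\<not> a \<ge> 3"
          then have "(2::int) ^ a \<le> 2 ^ 3" by (intro power_increasing) auto
          then have "(2::int) ^ a \<le> 8" by simp
          moreover have "(3::int) ^ d > 0" by simp
          ultimately show False using e by linarith
        qed
        then have "(2::int) ^ 3 dvd 2 ^ a" by (rule le_imp_power_dvd)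
        then have "8 dvd (3::int) ^ d + (48 * int m + 41)" unfolding e by simp
        then have "(3::int) ^ d mod 8 = 7" by presburger
        then show False unfolding power_3_mod_8 by (simp split: if_splits)
      qed
    next
      case True
      then have c: "c \<noteq> 0" using ac by simp
      have b: "b \<noteq> 0"
      proof
        assume "b = 0"
        then have "1 = 2 ^ c * 3 ^ d + int p" using eqi True by simp
        moreover have "(2::int) ^ c * 3 ^ d > 0" by simp
        ultimately show False using m by simp
      qed
      then have e: "(3::int) ^ b = 2 ^ c + (48 * int m + 41)" using eqi bd True m by simp
      have "(3::int) dvd 3 ^ b" using b by (simp add: dvd_power)
      then have "(2::int) ^ c mod 3 = 1" unfolding e by presburger
      then have ce: "even c" unfolding power_2_mod_3 by (simp split: if_splits)
      then obtain t where t: "c = 2 * t" by (elim evenE)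
      have "c \<noteq> 2"
      proof
        assume "c = 2"
        then have "(3::int) ^ b = 48 * int m + 45" using e by simp
        then have "(3::int) ^ b mod 8 = 5" by presburger
        then show False unfolding power_3_mod_8 by (simp split: if_splits)
      qed
      then have t2: "t \<ge> 2" using c t by (cases "t = 1") auto
      then have "(2::int) ^ 4 dvd 2 ^ c" using t by (intro le_imp_power_dvd) auto
      \<comment> \<open>41 is 9 modulo 16, which will force \<open>b\<close> to be 2 modulo
        4.\<close>
      then have b9: "(3::int) ^ b mod 16 = 9" unfolding e by simp presburger
      have "(3::int) ^ b mod 8 = 1" using b9 by presburger
      then have "even b" unfolding power_3_mod_8 by (simp split: if_splits)
      then obtain s where s: "b = 2 * s" by (elim evenE)
      have os: "odd s"
      proof
        assume "even s"
        then obtain r where "b = 4 * r" using s by auto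
        then have "(3::int) ^ b mod 16 = (81 ^ r) mod 16" by (simp add: power_mult)
        also have "\<dots> = 1" by (simp add: power_mod[of 81 16 r, symmetric])
        finally show False using b9 by simp
      qed
      have f: "int p = (3 ^ s - 2 ^ t) * (3 ^ s + 2 ^ t)"
        using eqi e m unfolding s t by (simp only: power_even_eq power2_eq_square) (simp add: algebra_simps)
      have "prime (int p)" using p by simp
      then have "is_unit ((3::int) ^ s - 2 ^ t) \<or> is_unit ((3::int) ^ s + 2 ^ t)"
        unfolding f by (auto dest!: prime_imp_prime_elem prime_elem_imp_irreducible irreducibleD[OF _ refl])
      moreover have "(3::int) ^ s + 2 ^ t > 1" by (smt (verit) one_le_power zero_less_power)
      ultimately have u: "\<bar>(3::int) ^ s - 2 ^ t\<bar> = 1" by auto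
      have "int p > 0" using m by simp
      then have "(3::int) ^ s - 2 ^ t > 0"
        unfolding f using \<open>3 ^ s + 2 ^ t > (1::int)\<close> by (simp add: zero_less_mult_iff)
      then have "(3::int) ^ s = 2 ^ t + 1" using u by simp
      moreover have "(2::int) ^ 2 dvd 2 ^ t" using t2 by (rule le_imp_power_dvd)
      ultimately have "(3::int) ^ s mod 4 = 1" by simp presburger
      then show False unfolding power_3_mod_4 using os by simp
    qed
  qed
  moreover have "p > 0" using m by simp
  ultimately show ?thesis unfolding ndh_iff by blast
qed

lemma ndh_41: "ndh 41"
proof (rule ndh_prime)
  show "prime (41::nat)" by simp
qed (simp add: cong_def)

section \<open>Multiples of 41 by powers of 2 and of 3\<close>

lemma power_mod_period:
  fixes g m b k :: nat
  assumes "g ^ k mod m = 1 mod m"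
  shows "g ^ b mod m = g ^ (b mod k) mod m"
proof -
  have "g ^ b mod m = g ^ (k * (b div k) + b mod k) mod m" by simp
  also have "\<dots> = (g ^ k mod m) ^ (b div k) * g ^ (b mod k) mod m"
    unfolding power_add power_mult by (metis mod_mult_left_eq power_mod)
  also have "\<dots> = g ^ (b mod k) mod m"
    unfolding assms by (metis mod_mult_left_eq power_mod power_one mult_1)
  finally show ?thesis .
qed

text \<open>The order of 3 modulo 41 is 8 and \<open>3^8 \<equiv> 1\<close> modulo 5.\<close>

lemma power_3_cong_1_mod_41:
  assumes "(3::nat) ^ b mod 41 = 1"
  shows "(3::nat) ^ b mod 5 = 1"
proof -
  define s where "s = b mod 8"
  have "(3::nat) ^ s mod 41 = 1" using power_mod_period[of 3 8 41 b] assms by (simp add: s_def)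
  moreover have "s \<in> {0, 1, 2, 3, 4, 5, 6, 7}" by (simp add: s_def) presburger
  ultimately have "s = 0" by auto
  then show ?thesis using power_mod_period[of 3 8 5 b] by (simp add: s_def)
qed

text \<open>The order of 2 modulo 41 is 20 and \<open>2^20 \<equiv> 1\<close> modulo 5.\<close>

lemma power_2_cong_1_mod_41:
  assumes "(2::nat) ^ b mod 41 = 1"
  shows "(2::nat) ^ b mod 5 = 1"
proof -
  define s where "s = b mod 20"
  have "(2::nat) ^ s mod 41 = 1" using power_mod_period[of 2 20 41 b] assms by (simp add: s_def)
  moreover have "s < 20" by (simp add: s_def)
  then have "s \<in> {0, 1, 2, 3, 4, 5, 6, 7, 8, 9, 10, 11, 12, 13, 14, 15, 16, 17, 18, 19}"
    unfolding insert_iff empty_iff by presburger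
  ultimately have "s = 0" by auto
  then show ?thesis using power_mod_period[of 2 20 5 b] by (simp add: s_def)
qed

lemma prime_ndvd_power_mult_41:
  fixes q r n :: nat
  assumes "prime q" "prime r" "q \<noteq> r" "q \<noteq> 41"
  shows "\<not> q dvd r ^ n * 41"
proof
  assume "q dvd r ^ n * 41"
  then have "q dvd r \<or> q dvd 41" using assms(1) by (metis prime_dvd_mult_iff prime_dvd_power)
  moreover have "prime (41::nat)" by simp
  ultimately show False using assms by (metis primes_dvd_imp_eq)
qed

lemma three_dvd_harmonic_iff: "3 dvd (2::nat) ^ i * 3 ^ j \<longleftrightarrow> j \<noteq> 0"
  using prime_dvd_mult_iff[of "3::nat" "2 ^ i" "3 ^ j"] prime_dvd_power[of "3::nat" 2 i]
  by (cases j) auto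

text \<open>The induction hypothesis excludes two even terms. Otherwise both are powers of 3, the
  smaller being 1; then \<open>3 ^ b\<close> is 1 modulo 41, hence modulo 5, and 5 would divide
  \<open>2 ^ Suc n * 41\<close>.\<close>

lemma ndh_power_2_mult_41: "ndh (2 ^ n * 41)"
proof (induction n)
  case 0
  then show ?case using ndh_41 by simp
next
  case (Suc n)
  have False if eq: "(2::nat) ^ a * 3 ^ b = 2 ^ c * 3 ^ d + 2 ^ Suc n * 41" for a b c d
  proof -
    have "even ((2::nat) ^ a * 3 ^ b) \<longleftrightarrow> even ((2::nat) ^ c * 3 ^ d)" unfolding eq by simp
    then have ac: "a = 0 \<longleftrightarrow> c = 0" by auto
    show False
    proof (cases a)
      case (Suc a')
      then obtain c' where c': "c = Suc c'" using ac by (cases c) auto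
      then have "(2::nat) ^ a' * 3 ^ b = 2 ^ c' * 3 ^ d + 2 ^ n * 41" using eq Suc by simp
      then show False using Suc.IH unfolding ndh_iff by blast
    next
      case 0
      then have e: "(3::nat) ^ b = 3 ^ d + 2 ^ Suc n * 41" using eq ac by simp
      have "(3::nat) ^ d < 3 ^ b" unfolding e by simp
      then have "b > 0" by simp
      then have b3: "(3::nat) dvd 3 ^ b" by (simp add: dvd_power)
      have "d = 0"
      proof (rule ccontr)
        assume "d \<noteq> 0"
        then have "(3::nat) dvd 3 ^ d" by (simp add: dvd_power)
        then have "3 dvd (2 ^ Suc n * 41 :: nat)" using b3 unfolding e by (simp only: dvd_add_right_iff)
        then show False using prime_ndvd_power_mult_41[of 3 2 "Suc n"] by simp
      qed
      then have e1: "(3::nat) ^ b = 1 + 2 ^ Suc n * 41" using e by simp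
      have "(3::nat) ^ b mod 41 = 1" unfolding e1 mod_mult_self1 by simp
      then have "(3::nat) ^ b mod 5 = 1" by (rule power_3_cong_1_mod_41)
      then have "5 dvd (2 ^ Suc n * 41 :: nat)" unfolding e1 by presburger
      then show False using prime_ndvd_power_mult_41[of 5 2 "Suc n"] by simp
    qed
  qed
  then show ?case unfolding ndh_iff by auto
qed

lemma ndh_power_3_mult_41: "ndh (3 ^ n * 41)"
proof (induction n)
  case 0
  then show ?case using ndh_41 by simp
next
  case (Suc n)
  have False if eq: "(2::nat) ^ a * 3 ^ b = 2 ^ c * 3 ^ d + 3 ^ Suc n * 41" for a b c d
  proof -
    have "3 dvd (2::nat) ^ a * 3 ^ b \<longleftrightarrow> 3 dvd (2::nat) ^ c * 3 ^ d"
      unfolding eq by (simp add: dvd_add_left_iff)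
    then have bd: "b = 0 \<longleftrightarrow> d = 0" unfolding three_dvd_harmonic_iff by blast
    show False
    proof (cases b)
      case (Suc b')
      then obtain d' where d': "d = Suc d'" using bd by (cases d) auto
      then have "(2::nat) ^ a * 3 ^ b' = 2 ^ c * 3 ^ d' + 3 ^ n * 41" using eq Suc by simp
      then show False using Suc.IH unfolding ndh_iff by blast
    next
      case 0
      then have e: "(2::nat) ^ a = 2 ^ c + 3 ^ Suc n * 41" using eq bd by simp
      have "(2::nat) ^ c < 2 ^ a" unfolding e by simp
      then have "a > 0" by simp
      then have "even ((2::nat) ^ a)" by simp
      then have "c = 0" unfolding e by simp
      then have e1: "(2::nat) ^ a = 1 + 3 ^ Suc n * 41" using e by simp
      have "(2::nat) ^ a mod 41 = 1" unfolding e1 mod_mult_self1 by simp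
      then have "(2::nat) ^ a mod 5 = 1" by (rule power_2_cong_1_mod_41)
      then have "5 dvd (3 ^ Suc n * 41 :: nat)" unfolding e1 by presburger
      then show False using prime_ndvd_power_mult_41[of 5 3 "Suc n"] by simp
    qed
  qed
  then show ?case unfolding ndh_iff by auto
qed

lemma ndh_double_or_triple:
  assumes x: "ndh x"
  shows "ndh (2 * x) \<or> ndh (3 * x)"
proof (rule ccontr)
  assume "\<not> ?thesis"
  moreover have x0: "x > 0" and nx: "\<And>a b c d. 2 ^ a * 3 ^ b \<noteq> 2 ^ c * 3 ^ d + x"
    using x unfolding ndh_iff by auto
  ultimately obtain a b c d a' b' c' d' where
    e2: "2 ^ a * 3 ^ b = 2 ^ c * 3 ^ d + 2 * x" and e3: "2 ^ a' * 3 ^ b' = 2 ^ c' * 3 ^ d' + 3 * x"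
    unfolding ndh_iff by auto
  \<comment> \<open>If both terms were even, halving them would represent \<open>x\<close>
    itself.\<close>
  have ac: "a = 0 \<and> c = 0"
  proof -
    have "even ((2::nat) ^ a * 3 ^ b) \<longleftrightarrow> even ((2::nat) ^ c * 3 ^ d)" unfolding e2 by simp
    then have "a = 0 \<longleftrightarrow> c = 0" by auto
    moreover have False if "a = Suc i" "c = Suc j" for i j
      using e2 that nx[of i b j d] by simp
    ultimately show ?thesis by (metis not0_implies_Suc)
  qed
  have bd: "b' = 0 \<and> d' = 0"
  proof -
    have "3 dvd (2::nat) ^ a' * 3 ^ b' \<longleftrightarrow> 3 dvd (2::nat) ^ c' * 3 ^ d'"
      unfolding e3 by (simp add: dvd_add_left_iff)
    then have "b' = 0 \<longleftrightarrow> d' = 0" unfolding three_dvd_harmonic_iff by blast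
    moreover have False if "b' = Suc i" "d' = Suc j" for i j
      using e3 that nx[of a' i c' j] by simp
    ultimately show ?thesis by (metis not0_implies_Suc)
  qed
  have n2: "(3::nat) ^ b = 3 ^ d + 2 * x" and n3: "(2::nat) ^ a' = 2 ^ c' + 3 * x"
    using e2 e3 ac bd by simp_all
  have "(3::nat) ^ d < 3 ^ b" "(2::nat) ^ c' < 2 ^ a'" using n2 n3 x0 by simp_all
  then have less: "d < b" "c' < a'" by simp_all
  have i: "(3::int) ^ b = 3 ^ d + 2 * int x" "(2::int) ^ a' = 2 ^ c' + 3 * int x"
    using arg_cong[OF n2, of int] arg_cong[OF n3, of int] by simp_all
  \<comment> \<open>Scaling by 3 and by 2 equates the differences and makes all exponents positive,
    as \<open>pillai\<close> requires.\<close>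
  then have "(3::int) ^ Suc b - 3 ^ Suc d = 6 * int x"
    and "(2::int) ^ Suc a' - 2 ^ Suc c' = 6 * int x" by simp_all
  then have "6 * int x \<in> {6, 24, 240}" using pillai[of "Suc b" "Suc d" "Suc a'" "Suc c'"] less by simp
  then consider "x = 1" | "x = 4" | "x = 40" by auto
  \<comment> \<open>The representations are 1 = 2 - 1, 4 = 8 - 4 and 40 = 48 - 8.\<close>
  then show False
    using nx[of 1 0 0 0] nx[of 3 0 2 0] nx[of 4 1 3 0] by cases auto
qed

theorem theorem2p4:
  "(\<forall>n :: nat. ndh (2 ^ n * 41)) \<and>
   (\<forall>n :: nat. ndh (3 ^ n * 41)) \<and>
   (\<forall>x :: nat. ndh x \<longrightarrow> ndh (2 * x) \<or> ndh (3 * x)) \<and>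
   (\<forall>p :: nat. prime p \<and> [p = 41] (mod 48) \<longrightarrow> ndh p)"
  using ndh_power_2_mult_41 ndh_power_3_mult_41 ndh_double_or_triple ndh_prime by blast

end
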